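(* Let $N\in\mathbb N_0$, $\alpha_1,\alpha_2,\beta>-1$, and let $\omega_1,\omega_2$ be the Hahn weights on $\{0,\dots,N\}$, assumed to form an algebraic Chebyshev (AT) system, so that the system is perfect (every index is normal). For $(n_1,n_2)\in\mathbb N_0^2$ let $Q^{(1)}_{(n_1,n_2)},Q^{(2)}_{(n_1,n_2)}$ be the type I multiple orthogonal Hahn polynomials, biorthogonal to the monic type II Hahn multiple orthogonal polynomials $Q_{(m_1,m_2)}$ (see the context). Then, for $a\in\{1,2\}$, $$Q_{(n_1,n_2)}^{(a)}(x)=K_a\;F^{2:3;1}_{2:2;0}\left[{(-n_a+1,-N):(\alpha_a+\beta+n_1+n_2,\ \alpha_a-\hat\alpha_a-\hat n_a+1,\ -x);(\hat\alpha_a-\alpha_a-n_a+1)\atop(-n_1-n_2+2,\ \hat\alpha_a+\beta+\hat n_a+1):(\alpha_a+1,\ -N);--}\Bigg|\,1,1\right]=\sum_{l=0}^{n_a-1}C^{(a),l}_{(n_1,n_2)}\,(-x)_l,$$ where $$K_a=\frac{(-1)^{n_a-1}(N+1-n_1-n_2)!\,(n_1+n_2-2)!}{(n_1-1)!\,(n_2-1)!\,(\beta+1)_{n_1+n_2-1}\,(\alpha_a+\beta+n_1+n_2+n_a)_{N+1-n_1-n_2}}\;\frac{(\hat\alpha_a+\beta+\hat n_a+1)_{n_1+n_2-1}}{(\alpha_a-\hat\alpha_a-\hat n_a+1)_{n_1+n_2-1}}$$ and $$C^{(a),l}_{(n_1,n_2)}=K_a\,\frac{(\alpha_a+\beta+n_1+n_2)_l\,(\alpha_a-\hat\alpha_a-\hat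 n_a+1)_l}{l!\,(\alpha_a+1)_l\,(-N)_l}\sum_{m=0}^{n_a-1-l}\frac{(-n_a+1)_{l+m}\,(-N)_{l+m}\,(\hat\alpha_a-\alpha_a-n_a+1)_m}{m!\,(-n_1-n_2+2)_{l+m}\,(\hat\alpha_a+\beta+\hat n_a+1)_{l+m}}.$$
   Context: Pochhammer symbol: $(x)_n=\Gamma(x+n)/\Gamma(x)$, i.e. $(x)_0=1$, $(x)_n=x(x+1)\cdots(x+n-1)$. Hahn weights, for $a\in\{1,2\}$ and $x\in\{0,\dots,N\}$: $$\omega_a(x)=\frac{\Gamma(\alpha_a+x+1)}{\Gamma(\alpha_a+1)\Gamma(x+1)}\,\frac{\Gamma(\beta+N-x+1)}{\Gamma(\beta+1)\Gamma(N-x+1)}.$$ Notation: $\hat\alpha_1=\alpha_2$, $\hat\alpha_2=\alpha_1$, $\hat n_1=n_2$, $\hat n_2=n_1$. The type I polynomials biorthogonal to the $Q_{(m_1,m_2)}$ satisfy $\deg Q^{(a)}_{(n_1,n_2)}\le n_a-1$ and, with $\mathscr Q_{(n_1,n_2)}(k)=Q^{(1)}_{(n_1,n_2)}(k)\omega_1(k)+Q^{(2)}_{(n_1,n_2)}(k)\omega_2(k)$, the orthogonality relations $\sum_{k=0}^N(-k)_j\mathscr Q_{(n_1,n_2)}(k)=0$ for $j\in\{0,\dots,n_1+n_2-2\}$ and the biorthogonality relations that $\sum_{k=0}^N\mathscr Q_{(n_1,n_2)}(k)Q_{(m_1,m_2)}(k)$ equals $0$ if $n_1\le m_1$ and $n_2\le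 m_2$, equals $1$ if $m_1+m_2=n_1+n_2-1$, and equals $0$ if $m_1+m_2\le n_1+n_2-2$. The monic type II Hahn polynomials satisfy $\sum_{k=0}^NQ_{(m_1,m_2)}(k)\omega_a(k)(-k)_j=0$ for $j\in\{0,\dots,m_a-1\}$, $a\in\{1,2\}$, and are given by $$Q_{(m_1,m_2)}(x)=\frac{(\alpha_1+1)_{m_1}(\alpha_2+1)_{m_2}(-N)_{m_1+m_2}}{(\alpha_1+\beta+m_1+m_2+1)_{m_1}(\alpha_2+\beta+m_1+m_2+1)_{m_2}}\sum_{l=0}^{m_1+m_2}\frac{(\alpha_1+\beta+m_1+1)_l}{(\alpha_1+1)_l}\sum_{r=0}^{l}\frac{(-m_1)_r(-m_2)_{l-r}}{r!(l-r)!}\frac{(\alpha_2+\beta+m_1+m_2+1)_{l-r}(\alpha_1+m_1+1)_{l-r}}{(\alpha_2+1)_{l-r}(\alpha_1+\beta+m_1+1)_{l-r}}\frac{(-x)_l}{(-N)_l}.$$ Kampé de Fériet series: $$F^{p:r;s}_{q:n;k}\left[{(a_1,\dots,a_p):(b_1,\dots,b_r);(c_1,\dots,c_s)\atop(\alpha_1,\dots,\alpha_q):(\beta_1,\dots,\beta_n);(\gamma_1,\dots,\gamma_k)}\Bigg|x,y\right]=\sum_{l,m\ge0}\frac{\prod_i(a_i)_{l+m}}{\prod_i(\alpha_i)_{l+m}}\frac{\prod_i(b_i)_l}{\prod_i(\beta_i)_l}\frac{\prod_i(c_i)_m}{\prod_i(\gamma_i)_m}\frac{x^l}{l!}\frac{y^m}{m!},$$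 "$--$" denoting an empty list of parameters.
   Formalization: The indices are restricted to n_1, n_2 ≥ 1 with n_1+n_2 ≤ N+1 instead of all of N_0^2, because otherwise (n_1-1)!, (n_2-1)! or (N+1-n_1-n_2)! in K_a is undefined. *)

theory Defs
  imports "HOL-Analysis.Analysis" "HOL-Computational_Algebra.Polynomial"
begin

text \<open>
  Data attached to the two weights (the weights themselves, the parameters \<open>\<alpha>\<^sub>1, \<alpha>\<^sub>2\<close>, the
  multi-index \<open>(n\<^sub>1, n\<^sub>2)\<close>, the pair of type I polynomials) are functions on \<^typ>\<open>nat\<close> of
  which only the values at \<open>1\<close> and \<open>2\<close> matter.  For \<open>a \<in> {1, 2}\<close>, \<open>hat a\<close> is the other
  element.
\<close>

definition hat :: "nat \<Rightarrow> nat" where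
  "hat a = (if a = 1 then 2 else 1)"

definition hahn_weight :: "nat \<Rightarrow> real \<Rightarrow> real \<Rightarrow> nat \<Rightarrow> real" where
  "hahn_weight N \<alpha> \<beta> x =
     Gamma (\<alpha> + real x + 1) / (Gamma (\<alpha> + 1) * Gamma (real x + 1)) *
     (Gamma (\<beta> + real N - real x + 1) / (Gamma (\<beta> + 1) * Gamma (real N - real x + 1)))"

text \<open>The condition \<open>deg p \<le> n - 1\<close>, which for \<open>n = 0\<close> means \<open>p = 0\<close>.\<close>

definition deg_less :: "real poly \<Rightarrow> nat \<Rightarrow> bool" where
  "deg_less p n \<longleftrightarrow> p = 0 \<or> degree p < n"

definition linear_form :: "(nat \<Rightarrow> nat \<Rightarrow> real) \<Rightarrow> (nat \<Rightarrow> real poly) \<Rightarrow> nat \<Rightarrow> real" where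
  "linear_form w P k = (\<Sum>a\<in>{1, 2}. poly (P a) (real k) * w a k)"

text \<open>
  For every multi-index with \<open>n\<^sub>1 + n\<^sub>2 \<le> N + 1\<close>, the functions
  \<open>w\<^sub>1, x w\<^sub>1, \<dots>, x\<^bsup>n\<^sub>1-1\<^esup> w\<^sub>1, w\<^sub>2, x w\<^sub>2, \<dots>, x\<^bsup>n\<^sub>2-1\<^esup> w\<^sub>2\<close> form a Chebyshev system on
  \<open>{0, \<dots>, N}\<close>: a nontrivial linear combination has at most \<open>n\<^sub>1 + n\<^sub>2 - 1\<close> zeros there.
  Larger multi-indices are excluded because the support has only \<open>N + 1\<close> points.
\<close>

definition AT_system :: "nat \<Rightarrow> (nat \<Rightarrow> nat \<Rightarrow> real) \<Rightarrow> bool" where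
  "AT_system N w \<longleftrightarrow>
     (\<forall>(n :: nat \<Rightarrow> nat) P.
        n 1 + n 2 \<le> N + 1 \<longrightarrow>
        (\<forall>a\<in>{1, 2}. deg_less (P a) (n a)) \<longrightarrow>
        (\<exists>a\<in>{1, 2}. P a \<noteq> 0) \<longrightarrow>
        card {k \<in> {0..N}. linear_form w P k = 0} \<le> n 1 + n 2 - 1)"

definition monic_type_II ::
  "nat \<Rightarrow> (nat \<Rightarrow> nat \<Rightarrow> real) \<Rightarrow> nat \<Rightarrow> nat \<Rightarrow> real poly \<Rightarrow> bool" where
  "monic_type_II N w m1 m2 Q \<longleftrightarrow>
     lead_coeff Q = 1 \<and> degree Q = m1 + m2 \<and>
     (\<forall>j<m1. (\<Sum>k=0..N. poly Q (real k) * w 1 k * pochhammer (- real k) j) = 0) \<and>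
     (\<forall>j<m2. (\<Sum>k=0..N. poly Q (real k) * w 2 k * pochhammer (- real k) j) = 0)"

text \<open>
  \<open>P 1, P 2\<close> are type I polynomials of multi-index \<open>(n 1, n 2)\<close>, biorthogonal to the family
  \<open>QII m\<^sub>1 m\<^sub>2\<close>, \<open>m\<^sub>1 + m\<^sub>2 \<le> N\<close>.  The subtractions in \<open>j \<le> n\<^sub>1 + n\<^sub>2 - 2\<close>,
  \<open>m\<^sub>1 + m\<^sub>2 = n\<^sub>1 + n\<^sub>2 - 1\<close> and \<open>m\<^sub>1 + m\<^sub>2 \<le> n\<^sub>1 + n\<^sub>2 - 2\<close> are moved to the other side, since
  they would be truncated on \<^typ>\<open>nat\<close>.
\<close>

definition type_I ::
  "nat \<Rightarrow> (nat \<Rightarrow> nat \<Rightarrow> real) \<Rightarrow> (nat \<Rightarrow> nat \<Rightarrow> real poly) \<Rightarrow> (nat \<Rightarrow> nat) \<Rightarrow>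
     (nat \<Rightarrow> real poly) \<Rightarrow> bool" where
  "type_I N w QII n P \<longleftrightarrow>
     (\<forall>a\<in>{1, 2}. deg_less (P a) (n a)) \<and>
     (\<forall>j. j + 2 \<le> n 1 + n 2 \<longrightarrow>
        (\<Sum>k=0..N. pochhammer (- real k) j * linear_form w P k) = 0) \<and>
     (\<forall>m1 m2. m1 + m2 \<le> N \<longrightarrow>
        (n 1 \<le> m1 \<and> n 2 \<le> m2 \<longrightarrow>
           (\<Sum>k=0..N. linear_form w P k * poly (QII m1 m2) (real k)) = 0) \<and>
        (m1 + m2 + 1 = n 1 + n 2 \<longrightarrow>
           (\<Sum>k=0..N. linear_form w P k * poly (QII m1 m2) (real k)) = 1) \<and>
        (m1 + m2 + 2 \<le> n 1 + n 2 \<longrightarrow>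
           (\<Sum>k=0..N. linear_form w P k * poly (QII m1 m2) (real k)) = 0))"

definition pochhammers :: "real list \<Rightarrow> nat \<Rightarrow> real" where
  "pochhammers cs n = (\<Prod>c\<leftarrow>cs. pochhammer c n)"

text \<open>
  The Kampe de Feriet series; numerator parameters \<open>as : bs; cs\<close>, denominator parameters
  \<open>ds : es; fs\<close>.  If a nonpositive integer among the numerator parameters makes the series
  terminate, the terms beyond that point vanish even where a denominator parameter is also a
  nonpositive integer, because \<open>0 / 0 = 0\<close>.
\<close>

definition kampe_de_feriet ::
  "real list \<Rightarrow> real list \<Rightarrow> real list \<Rightarrow> real list \<Rightarrow> real list \<Rightarrow> real list \<Rightarrow>
     real \<Rightarrow> real \<Rightarrow> real" where
  "kampe_de_feriet as bs cs ds es fs x y =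
     (\<Sum>\<^sub>\<infinity>(l, m)\<in>UNIV.
        pochhammers as (l + m) / pochhammers ds (l + m) *
        (pochhammers bs l / pochhammers es l) *
        (pochhammers cs m / pochhammers fs m) *
        (x ^ l / fact l) * (y ^ m / fact m))"

text \<open>
  The subtractions on \<^typ>\<open>nat\<close> below are not truncated for \<open>n 1, n 2 \<ge> 1\<close> and
  \<open>n 1 + n 2 \<le> N + 1\<close>, the range in which the factorials are defined.
\<close>

definition hahn_K ::
  "nat \<Rightarrow> (nat \<Rightarrow> real) \<Rightarrow> real \<Rightarrow> (nat \<Rightarrow> nat) \<Rightarrow> nat \<Rightarrow> real" where
  "hahn_K N \<alpha> \<beta> n a =
     (-1) ^ (n a - 1) * fact (N + 1 - n 1 - n 2) * fact (n 1 + n 2 - 2) /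
     (fact (n 1 - 1) * fact (n 2 - 1) *
        pochhammer (\<beta> + 1) (n 1 + n 2 - 1) *
        pochhammer (\<alpha> a + \<beta> + real (n 1) + real (n 2) + real (n a)) (N + 1 - n 1 - n 2)) *
     (pochhammer (\<alpha> (hat a) + \<beta> + real (n (hat a)) + 1) (n 1 + n 2 - 1) /
      pochhammer (\<alpha> a - \<alpha> (hat a) - real (n (hat a)) + 1) (n 1 + n 2 - 1))"

definition hahn_C ::
  "nat \<Rightarrow> (nat \<Rightarrow> real) \<Rightarrow> real \<Rightarrow> (nat \<Rightarrow> nat) \<Rightarrow> nat \<Rightarrow> nat \<Rightarrow> real" where
  "hahn_C N \<alpha> \<beta> n a l =
     hahn_K N \<alpha> \<beta> n a *
     (pochhammer (\<alpha> a + \<beta> + real (n 1) + real (n 2)) l *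
        pochhammer (\<alpha> a - \<alpha> (hat a) - real (n (hat a)) + 1) l /
      (fact l * pochhammer (\<alpha> a + 1) l * pochhammer (- real N) l)) *
     (\<Sum>m=0..n a - 1 - l.
        pochhammer (- real (n a) + 1) (l + m) * pochhammer (- real N) (l + m) *
          pochhammer (\<alpha> (hat a) - \<alpha> a - real (n a) + 1) m /
        (fact m * pochhammer (- real (n 1) - real (n 2) + 2) (l + m) *
          pochhammer (\<alpha> (hat a) + \<beta> + real (n (hat a)) + 1) (l + m)))"

end

theory Submission
  imports Defs
begin

text \<open>
  Put \<open>M = n\<^sub>1 + n\<^sub>2 - 1\<close> and expand \<open>Q\<^sup>(\<^sup>a\<^sup>)\<close> in the Pochhammer symbols \<open>(\<alpha>\<^sub>a + 1 + x)\<^sub>i\<close>.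
  Since \<open>(\<alpha> + 1 + x)\<^sub>i\<close> times a Hahn weight is a Hahn weight with parameter \<open>\<alpha> + i\<close>, the
  Chu-Vandermonde sum evaluates all moments, and the orthogonality relations become
  \<open>\<Sum>\<^sub>s d\<^sub>s g\<^sub>j(s) = 0\<close> for \<open>j < M\<close>, with a known value at \<open>j = M\<close>.  Here \<open>s\<close> runs through the
  \<open>M + 1\<close> nodes \<open>\<alpha>\<^sub>a + i\<close>, \<open>i < n\<^sub>a\<close>, the numbers \<open>d\<^sub>s\<close> are the rescaled coefficients, and
  \<open>g\<^sub>j(s) = (s + 1)\<^sub>j (s + \<beta> + j + 2)\<^sub>M\<^sub>-\<^sub>j\<close>.  The \<open>g\<^sub>j\<close> span the polynomials of degree at most
  \<open>M\<close>, and all of them except \<open>g\<^sub>M\<close> vanish at \<open>z = - \<beta> - M - 1\<close>.  Hence \<open>p \<mapsto> \<Sum>\<^sub>s d\<^sub>s p(s)\<close> is a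
  multiple of the evaluation at \<open>z\<close>, and Lagrange interpolation gives the \<open>d\<^sub>s\<close> as products.
  The nodes are distinct because otherwise one weight would be a polynomial of low degree times the
  other, against the AT property.  Re-expansion in \<open>(-x)\<^sub>l\<close> yields terminating \<open>\<^sub>3F\<^sub>2(1)\<close>
  sums, which a Thomae transformation and a reversal of the summation turn into the stated ones.
\<close>

subsection \<open>Terminating hypergeometric sums\<close>

lemma triangle_swap:
  fixes f :: "nat \<Rightarrow> nat \<Rightarrow> 'a::comm_monoid_add"
  shows "(\<Sum>i\<le>n. \<Sum>l\<le>i. f i l) = (\<Sum>l\<le>n. \<Sum>m\<le>n - l. f (l + m) l)"
proof -
  have "(\<Sum>i\<le>n. \<Sum>l\<le>i. f i l) = (\<Sum>(i, l)\<in>(SIGMA i:{..n}. {..i}). f i l)"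
    by (simp add: sum.Sigma)
  also have "\<dots> = (\<Sum>(l, m)\<in>(SIGMA l:{..n}. {..n - l}). f (l + m) l)"
    by (rule sum.reindex_bij_witness[of _ "\<lambda>(l, m). (l + m, l)" "\<lambda>(i, l). (l, i - l)"]) auto
  also have "\<dots> = (\<Sum>l\<le>n. \<Sum>m\<le>n - l. f (l + m) l)"
    by (simp add: sum.Sigma)
  finally show ?thesis .
qed

text \<open>The value of 2F1(-n, b; d; 1), multiplied through by (d)_n so that it also covers
  nonpositive integers d. It is the binomial theorem for Pochhammer symbols at b and 1 - d - n, with
  (1 - d - n)_(n-k) reflected into (d + k)_(n-k).\<close>

lemma chu_vandermonde:
  fixes b d :: real
  shows "(\<Sum>k\<le>n. real (n choose k) * (-1) ^ k * pochhammer b k * pochhammer (d + real k) (n - k)) =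
    pochhammer (d - b) n"
proof -
  have "pochhammer (d - b) n = (-1) ^ n * pochhammer (b + (1 - d - real n)) n"
    using pochhammer_minus[of "b - d" n] by (simp add: algebra_simps)
  also have "\<dots> = (\<Sum>k\<le>n. (-1) ^ n * (real (n choose k) * pochhammer b k *
      pochhammer (1 - d - real n) (n - k)))"
    by (simp add: pochhammer_binomial_sum sum_distrib_left)
  also have "\<dots> = (\<Sum>k\<le>n. real (n choose k) * (-1) ^ k * pochhammer b k * pochhammer (d + real k) (n - k))"
  proof (rule sum.cong)
    fix k assume k: "k \<in> {..n}"
    have 1: "pochhammer (1 - d - real n) (n - k) = (-1) ^ (n - k) * pochhammer (d + real k) (n - k)"
      using pochhammer_minus[of "d + real n - 1" "n - k"] k by (simp add: of_nat_diff algebra_simps)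
    have 2: "(-1::real) ^ k = (-1) ^ n * (-1) ^ (n - k)"
      using k by (simp add: minus_one_power_iff)
    show "(-1) ^ n * (real (n choose k) * pochhammer b k * pochhammer (1 - d - real n) (n - k)) =
        real (n choose k) * (-1) ^ k * pochhammer b k * pochhammer (d + real k) (n - k)"
      unfolding 1 2 by (simp only: mult_ac)
  qed simp
  finally show ?thesis by simp
qed

text \<open>The left side is (d)_n (e)_n 3F2(-n, b, c; d, e; 1) with denominators cleared.
  Chu-Vandermonde expands (b)_m in the symbols (d - b)_k. Once the summations are exchanged, the sum
  over r = m - k is again of Chu-Vandermonde type, with parameters c + k and e + k.\<close>

lemma terminating_3F2_expansion:
  fixes b c d e :: real
  shows "(\<Sum>m\<le>n. real (n choose m) * (-1) ^ m * pochhammer b m * pochhammer c m *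
      pochhammer (d + real m) (n - m) * pochhammer (e + real m) (n - m)) =
    (\<Sum>k\<le>n. real (n choose k) * pochhammer c k * pochhammer (d - b) k *
      pochhammer (d + real k) (n - k) * pochhammer (e - c) (n - k))"
proof -
  define f where "f m k = real (n choose m) * real (m choose k) * (-1) ^ (m + k) * pochhammer c m *
      pochhammer (e + real m) (n - m) * pochhammer (d - b) k * pochhammer (d + real k) (n - k)" for m k
  have "(\<Sum>m\<le>n. real (n choose m) * (-1) ^ m * pochhammer b m * pochhammer c m *
      pochhammer (d + real m) (n - m) * pochhammer (e + real m) (n - m)) = (\<Sum>m\<le>n. \<Sum>k\<le>m. f m k)"
  proof (rule sum.cong)
    fix m assume m: "m \<in> {..n}"
    have "pochhammer b m = (\<Sum>k\<le>m. real (m choose k) * (-1) ^ k * pochhammer (d - b) k *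
        pochhammer (d + real k) (m - k))"
      using chu_vandermonde[of m "d - b" d] by simp
    then have "real (n choose m) * (-1) ^ m * pochhammer b m * pochhammer c m *
      pochhammer (d + real m) (n - m) * pochhammer (e + real m) (n - m) =
      (\<Sum>k\<le>m. real (n choose m) * (-1) ^ m * (real (m choose k) * (-1) ^ k * pochhammer (d - b) k *
        pochhammer (d + real k) (m - k)) * pochhammer c m *
      pochhammer (d + real m) (n - m) * pochhammer (e + real m) (n - m))"
      by (simp only: sum_distrib_left sum_distrib_right)
    also have "\<dots> = (\<Sum>k\<le>m. f m k)"
    proof (rule sum.cong)
      fix k assume k: "k \<in> {..m}"
      have "pochhammer (d + real k) (n - k) = pochhammer (d + real k) (m - k) * pochhammer (d + real m) (n - m)"
        using pochhammer_product'[of "d + real k" "m - k" "n - m"] k m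
        by (simp add: of_nat_diff add.assoc)
      then show "real (n choose m) * (-1) ^ m * (real (m choose k) * (-1) ^ k * pochhammer (d - b) k *
        pochhammer (d + real k) (m - k)) * pochhammer c m *
      pochhammer (d + real m) (n - m) * pochhammer (e + real m) (n - m) = f m k"
        unfolding f_def by (simp add: power_add)
    qed simp
    finally show "real (n choose m) * (-1) ^ m * pochhammer b m * pochhammer c m *
      pochhammer (d + real m) (n - m) * pochhammer (e + real m) (n - m) = (\<Sum>k\<le>m. f m k)" .
  qed simp
  also have "\<dots> = (\<Sum>k\<le>n. \<Sum>r\<le>n - k. f (k + r) k)"
    by (rule triangle_swap)
  also have "\<dots> = (\<Sum>k\<le>n. real (n choose k) * pochhammer c k * pochhammer (d - b) k *
      pochhammer (d + real k) (n - k) * pochhammer (e - c) (n - k))"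
  proof (rule sum.cong)
    fix k assume k: "k \<in> {..n}"
    have "(\<Sum>r\<le>n - k. f (k + r) k) = (\<Sum>r\<le>n - k. real (n choose k) * pochhammer c k * pochhammer (d - b) k *
      pochhammer (d + real k) (n - k) * (real ((n - k) choose r) * (-1) ^ r * pochhammer (c + real k) r *
        pochhammer (e + real k + real r) (n - k - r)))"
    proof (rule sum.cong)
      fix r assume r: "r \<in> {..n - k}"
      have "(n choose (k + r)) * ((k + r) choose k) = (n choose k) * ((n - k) choose r)"
        using choose_mult[of k "k + r" n] k r by simp
      then have "real (n choose (k + r)) * real ((k + r) choose k) = real (n choose k) * real ((n - k) choose r)"
        by (metis of_nat_mult)
      moreover have "(-1::real) ^ (k + r + k) = (-1) ^ r"
        by (simp add: minus_one_power_iff)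
      ultimately show "f (k + r) k = real (n choose k) * pochhammer c k * pochhammer (d - b) k *
      pochhammer (d + real k) (n - k) * (real ((n - k) choose r) * (-1) ^ r * pochhammer (c + real k) r *
        pochhammer (e + real k + real r) (n - k - r))"
        unfolding f_def by (simp add: pochhammer_product' add.assoc)
    qed simp
    also have "\<dots> = real (n choose k) * pochhammer c k * pochhammer (d - b) k *
      pochhammer (d + real k) (n - k) * pochhammer (e - c) (n - k)"
      using chu_vandermonde[of "n - k" "c + real k" "e + real k"]
      by (simp add: sum_distrib_left[symmetric])
    finally show "(\<Sum>r\<le>n - k. f (k + r) k) = real (n choose k) * pochhammer c k * pochhammer (d - b) k *
      pochhammer (d + real k) (n - k) * pochhammer (e - c) (n - k)" .
  qed simp
  finally show ?thesis .
qed

text \<open>The right side of \<open>terminating_3F2_expansion\<close> is symmetric in c and d - b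
  for fixed d and e - c. Replacing (b, c, e) by (d - c, d - b, d + e - b - c) swaps c with d - b and
  keeps e - c.\<close>

lemma terminating_3F2_transformation:
  fixes b c d e :: real
  shows "(\<Sum>m\<le>n. real (n choose m) * (-1) ^ m * pochhammer b m * pochhammer c m *
      pochhammer (d + real m) (n - m) * pochhammer (e + real m) (n - m)) =
    (\<Sum>m\<le>n. real (n choose m) * (-1) ^ m * pochhammer (d - b) m * pochhammer (d - c) m *
      pochhammer (d + real m) (n - m) * pochhammer (d + e - b - c + real m) (n - m))"
proof -
  have "(\<Sum>m\<le>n. real (n choose m) * (-1) ^ m * pochhammer (d - b) m * pochhammer (d - c) m *
      pochhammer (d + real m) (n - m) * pochhammer (d + e - b - c + real m) (n - m)) =
      (\<Sum>m\<le>n. real (n choose m) * (-1) ^ m * pochhammer (d - c) m * pochhammer (d - b) m *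
      pochhammer (d + real m) (n - m) * pochhammer (d + e - b - c + real m) (n - m))"
    by (simp add: mult_ac)
  also have "\<dots> = (\<Sum>k\<le>n. real (n choose k) * pochhammer (d - b) k * pochhammer c k *
      pochhammer (d + real k) (n - k) * pochhammer (e - c) (n - k))"
    using terminating_3F2_expansion[of n "d - c" "d - b" d "d + e - b - c"]
    by (simp add: algebra_simps)
  also have "\<dots> = (\<Sum>m\<le>n. real (n choose m) * (-1) ^ m * pochhammer b m * pochhammer c m *
      pochhammer (d + real m) (n - m) * pochhammer (e + real m) (n - m))"
    unfolding terminating_3F2_expansion by (simp add: mult_ac)
  finally show ?thesis ..
qed

section \<open>Matching the re-expansion sums with the stated inner sums\<close>

lemma pochhammer_minus_nat:
  assumes "t \<le> n"
  shows "pochhammer (- real n) t = (-1) ^ t * fact n / fact (n - t)"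
proof -
  have "fact n = (fact (n - t) :: real) * pochhammer (1 + real (n - t)) t"
    using pochhammer_product'[of "1::real" "n - t" t] assms by (simp add: pochhammer_fact)
  then show ?thesis
    using pochhammer_minus[of "real n" t] assms by (simp add: of_nat_diff algebra_simps)
qed

text \<open>The transformed summand at the reversed index r = p - l - m; \<delta> will be A - B.
  Reflection and splitting of Pochhammer symbols trade length r for length l + m. The signs (-1)^r
  and (-1)^m each occur twice and cancel. The bounds l + m \<le> p \<le> M - 1 < N and u > 0 keep
  the denominators nonzero.\<close>

lemma thomae_reversed_term:
  fixes u \<delta> :: real
  assumes q: "q \<ge> 1" and M: "M = p + q" "M \<le> N" and t: "l + m \<le> p" and u: "u > 0"
  shows "real (p choose l) * (real ((p - l) choose (p - l - m)) * (-1) ^ (p - l - m) * pochhammer (real q) (p - l - m) *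
      pochhammer (- (u + real p - 1)) (p - l - m) * pochhammer (\<delta> + 1 + real l + real (p - l - m)) m *
      pochhammer (real q + real (N - M) + 1 + real (p - l - m)) m) =
    fact (M - 1) * pochhammer u p / (fact (q - 1) * fact l * pochhammer (- real N) l) *
      (pochhammer (- real p) (l + m) * pochhammer (- real N) (l + m) * pochhammer (- \<delta> - real p) m /
        (fact m * pochhammer (- real (M - 1)) (l + m) * pochhammer u (l + m)))"
proof -
  define r where "r = p - l - m"
  have r: "p = l + m + r" using t by (simp add: r_def)
  define s :: real where "s = (-1) ^ (l + m)"
  have s: "s \<noteq> 0" by (simp add: s_def)
  have f1: "pochhammer (- real p) (l + m) = s * fact p / fact r"
    using pochhammer_minus_nat[OF t] by (simp add: s_def r)
  have f2: "pochhammer (- real (M - 1)) (l + m) = s * fact (M - 1) / fact (q - 1 + r)"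
  proof -
    have "M - 1 - (l + m) = q - 1 + r" "l + m \<le> M - 1" using q M r by simp_all
    then show ?thesis using pochhammer_minus_nat[of "l + m" "M - 1"] unfolding s_def by simp
  qed
  have f3: "pochhammer (real q) r = fact (q - 1 + r) / fact (q - 1)"
  proof -
    have "fact (q - 1 + r) = fact (q - 1) * pochhammer (real q) r"
      using pochhammer_product'[of "1::real" "q - 1" r] q by (simp add: pochhammer_fact of_nat_diff)
    then show ?thesis by simp
  qed
  have f4: "pochhammer (- (u + real p - 1)) r = (-1) ^ r * pochhammer (u + real (l + m)) r"
    unfolding pochhammer_minus by (simp add: r)
  have f5: "pochhammer u p = pochhammer u (l + m) * pochhammer (u + real (l + m)) r"
    unfolding r pochhammer_product'[of u "l + m" r] ..
  have f6: "pochhammer (\<delta> + 1 + real l + real r) m = (-1) ^ m * pochhammer (- \<delta> - real p) m"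
    using pochhammer_minus[of "\<delta> + real p" m] by (simp add: r algebra_simps flip: power_mult_distrib)
  have f7: "pochhammer (real q + real (N - M) + 1 + real r) m = (-1) ^ m * pochhammer (- real N + real l) m"
    using pochhammer_minus[of "real N - real l" m] M
    by (simp add: r of_nat_diff algebra_simps flip: power_mult_distrib)
  have f8: "pochhammer (- real N) (l + m) = pochhammer (- real N) l * pochhammer (- real N + real l) m"
    by (rule pochhammer_product')
  have f9: "real (p choose l) = fact p / (fact l * fact (m + r))" "real ((p - l) choose r) = fact (m + r) / (fact m * fact r)"
    by (simp_all add: r binomial_fact)
  have nz: "pochhammer u (l + m) \<noteq> 0" "pochhammer (- real N) l \<noteq> 0"
    using u t M by (auto simp: pochhammer_of_nat_eq_0_iff intro!: less_imp_neq[symmetric] pochhammer_pos)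
  have sq: "(-1::real) ^ r * (-1) ^ r = 1" "(-1::real) ^ m * (-1) ^ m = 1"
    by (simp_all flip: power_mult_distrib)
  have "real (p choose l) * (real ((p - l) choose r) * (-1) ^ r * pochhammer (real q) r *
      pochhammer (- (u + real p - 1)) r * pochhammer (\<delta> + 1 + real l + real r) m *
      pochhammer (real q + real (N - M) + 1 + real r) m) =
    real (p choose l) * real ((p - l) choose r) * pochhammer (real q) r * pochhammer (u + real (l + m)) r *
      pochhammer (- \<delta> - real p) m * pochhammer (- real N + real l) m * ((-1) ^ r * (-1) ^ r) * ((-1) ^ m * (-1) ^ m)"
    unfolding f4 f6 f7 by (simp only: mult_ac)
  also have "\<dots> = fact p / (fact l * fact m * fact r) * (fact (q - 1 + r) / fact (q - 1)) * pochhammer (u + real (l + m)) r *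
      pochhammer (- \<delta> - real p) m * pochhammer (- real N + real l) m"
    unfolding sq f9 f3 by simp
  also have "\<dots> = fact (M - 1) * pochhammer u p / (fact (q - 1) * fact l * pochhammer (- real N) l) *
      (pochhammer (- real p) (l + m) * pochhammer (- real N) (l + m) * pochhammer (- \<delta> - real p) m /
        (fact m * pochhammer (- real (M - 1)) (l + m) * pochhammer u (l + m)))"
    unfolding f1 f2 f5 f8 using nz s by (simp add: field_simps)
  finally show ?thesis unfolding r_def .
qed

text \<open>A and B will be the parameters of the two weights, p = n_a - 1, and q the other index.
  The left side is what the change to the basis (-x)_l produces, the right side the inner sum of
  \<open>hahn_C\<close>; the link is the 3F2 transformation followed by a reversal.\<close>

lemma thomae_reversed_sum:
  fixes A B \<beta> :: real and q :: nat
  defines "y \<equiv> A - B - real q + 1" and "u \<equiv> B + \<beta> + real q + 1"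
  assumes q: "q \<ge> 1" and M: "M = p + q" "M \<le> N" and l: "l \<le> p" and u: "u > 0"
    and x: "x = A + \<beta> + real M + 1"
  shows "(\<Sum>m\<le>p - l. real ((l + m) choose l) * ((-1) ^ (l + m) * real (p choose (l + m)) *
      pochhammer x (l + m) * pochhammer y (l + m) *
        pochhammer (x + real (N - M) + 1 + real (l + m)) (p - (l + m)) *
        pochhammer (y + real q + real (l + m)) (p - (l + m)))) =
    (-1) ^ l * pochhammer x l * pochhammer y l *
      (fact (M - 1) * pochhammer u p / (fact (q - 1) * fact l * pochhammer (- real N) l)) *
      (\<Sum>m\<le>p - l. pochhammer (- real p) (l + m) * pochhammer (- real N) (l + m) * pochhammer (B - A - real p) m /
        (fact m * pochhammer (- real (M - 1)) (l + m) * pochhammer u (l + m)))"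
proof -
  \<comment> \<open>Shifting all four parameters by l absorbs the offset l in the index: up to
    factors depending on l alone, the sum becomes a terminating 3F2 of length p - l.\<close>
  define b c d e where "b = x + real l" and "c = y + real l" and "d = y + real q + real l"
    and "e = x + real (N - M) + 1 + real l"
  define G where "G m = real ((p - l) choose m) * (-1) ^ m * pochhammer (real q) m *
      pochhammer (- (u + real p - 1)) m * pochhammer (A - B + 1 + real l + real m) (p - l - m) *
      pochhammer (real q + real (N - M) + 1 + real m) (p - l - m)" for m
  have "(\<Sum>m\<le>p - l. real ((l + m) choose l) * ((-1) ^ (l + m) * real (p choose (l + m)) *
      pochhammer x (l + m) * pochhammer y (l + m) *
        pochhammer (x + real (N - M) + 1 + real (l + m)) (p - (l + m)) *
        pochhammer (y + real q + real (l + m)) (p - (l + m)))) =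
    (\<Sum>m\<le>p - l. (-1) ^ l * pochhammer x l * pochhammer y l * real (p choose l) *
      (real ((p - l) choose m) * (-1) ^ m * pochhammer c m * pochhammer b m *
        pochhammer (d + real m) (p - l - m) * pochhammer (e + real m) (p - l - m)))"
  proof (rule sum.cong)
    fix m assume m: "m \<in> {..p - l}"
    have "(p choose (l + m)) * ((l + m) choose l) = (p choose l) * ((p - l) choose m)"
      using choose_mult[of l "l + m" p] m l by simp
    then have 1: "real ((l + m) choose l) * real (p choose (l + m)) = real (p choose l) * real ((p - l) choose m)"
      by (metis of_nat_mult mult.commute)
    have 2: "pochhammer (x + real (N - M) + 1 + real (l + m)) (p - (l + m)) = pochhammer (e + real m) (p - l - m)"
      "pochhammer (y + real q + real (l + m)) (p - (l + m)) = pochhammer (d + real m) (p - l - m)"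
      by (simp_all add: e_def d_def add_ac)
    have 3: "real ((l + m) choose l) * ((-1) ^ (l + m) * real (p choose (l + m)) *
      pochhammer x (l + m) * pochhammer y (l + m) * D * E) =
      (-1) ^ l * pochhammer x l * pochhammer y l * real (p choose l) *
      (real ((p - l) choose m) * (-1) ^ m * pochhammer c m * pochhammer b m * E * D)" for D E
      using 1 by (simp add: pochhammer_product' b_def c_def power_add)
    show "real ((l + m) choose l) * ((-1) ^ (l + m) * real (p choose (l + m)) *
      pochhammer x (l + m) * pochhammer y (l + m) *
        pochhammer (x + real (N - M) + 1 + real (l + m)) (p - (l + m)) *
        pochhammer (y + real q + real (l + m)) (p - (l + m))) = (-1) ^ l * pochhammer x l * pochhammer y l * real (p choose l) *
      (real ((p - l) choose m) * (-1) ^ m * pochhammer c m * pochhammer b m *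
        pochhammer (d + real m) (p - l - m) * pochhammer (e + real m) (p - l - m))"
      unfolding 2 by (rule 3)
  qed simp
  also have "\<dots> = (-1) ^ l * pochhammer x l * pochhammer y l * real (p choose l) *
      (\<Sum>m\<le>p - l. real ((p - l) choose m) * (-1) ^ m * pochhammer c m * pochhammer b m *
        pochhammer (d + real m) (p - l - m) * pochhammer (e + real m) (p - l - m))"
    by (simp only: sum_distrib_left)
  also have "\<dots> = (-1) ^ l * pochhammer x l * pochhammer y l * real (p choose l) *
      (\<Sum>m\<le>p - l. real ((p - l) choose m) * (-1) ^ m * pochhammer (d - c) m * pochhammer (d - b) m *
      pochhammer (d + real m) (p - l - m) * pochhammer (d + e - c - b + real m) (p - l - m))"
    unfolding terminating_3F2_transformation[of "p - l" c b d e] ..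
  \<comment> \<open>By the relations between x, y and u, the new upper parameters q and -(u + p - 1)
    are free of l.\<close>
  also have "d - c = real q" by (simp add: d_def c_def)
  also have "d - b = - (u + real p - 1)"
    by (simp add: d_def b_def x y_def u_def M)
  also have "d + e - c - b = real q + real (N - M) + 1"
    by (simp add: d_def b_def c_def e_def)
  also have "d = A - B + 1 + real l"
    by (simp add: d_def y_def)
  \<comment> \<open>Reversal of the summation order, m to p - l - m, so that
    \<open>thomae_reversed_term\<close> applies termwise.\<close>
  also have "(\<Sum>m\<le>p - l. real ((p - l) choose m) * (-1) ^ m * pochhammer (real q) m *
      pochhammer (- (u + real p - 1)) m * pochhammer (A - B + 1 + real l + real m) (p - l - m) *
      pochhammer (real q + real (N - M) + 1 + real m) (p - l - m)) = (\<Sum>m\<le>p - l. G (p - l - m))"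
    using sum.nat_diff_reindex[of G "Suc (p - l)"] by (simp add: G_def lessThan_Suc_atMost)
  also have "(-1) ^ l * pochhammer x l * pochhammer y l * real (p choose l) * \<dots> =
      (-1) ^ l * pochhammer x l * pochhammer y l * (\<Sum>m\<le>p - l. real (p choose l) * G (p - l - m))"
    by (simp add: sum_distrib_left mult_ac)
  also have "(\<Sum>m\<le>p - l. real (p choose l) * G (p - l - m)) =
      fact (M - 1) * pochhammer u p / (fact (q - 1) * fact l * pochhammer (- real N) l) *
      (\<Sum>m\<le>p - l. pochhammer (- real p) (l + m) * pochhammer (- real N) (l + m) * pochhammer (B - A - real p) m /
        (fact m * pochhammer (- real (M - 1)) (l + m) * pochhammer u (l + m)))"
    unfolding sum_distrib_left
  proof (rule sum.cong)
    fix m assume m: "m \<in> {..p - l}"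
    then have "p - l - (p - l - m) = m" "l + m \<le> p" using l by auto
    then show "real (p choose l) * G (p - l - m) = fact (M - 1) * pochhammer u p / (fact (q - 1) * fact l * pochhammer (- real N) l) *
      (pochhammer (- real p) (l + m) * pochhammer (- real N) (l + m) * pochhammer (B - A - real p) m /
        (fact m * pochhammer (- real (M - 1)) (l + m) * pochhammer u (l + m)))"
      using thomae_reversed_term[OF q M _ u, of l m "A - B"] unfolding G_def by simp
  qed simp
  finally show ?thesis unfolding mult.assoc .
qed

text \<open>Chu-Vandermonde with b = -x and d = u expands (u + x)_i in the symbols (-x)_l; the terms
  are then regrouped by l.\<close>

lemma shifted_to_factorial_basis:
  fixes u x :: real
  shows "(\<Sum>i\<le>p. b i * pochhammer (u + x) i) =
    (\<Sum>l\<le>p. (\<Sum>m\<le>p - l. b (l + m) * (real ((l + m) choose l) * (-1) ^ l * pochhammer (u + real l) m)) *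
      pochhammer (- x) l)"
proof -
  have "(\<Sum>i\<le>p. b i * pochhammer (u + x) i) =
      (\<Sum>i\<le>p. \<Sum>l\<le>i. b i * (real (i choose l) * (-1) ^ l * pochhammer (- x) l * pochhammer (u + real l) (i - l)))"
    using chu_vandermonde[of _ "- x" u] by (simp add: sum_distrib_left[symmetric])
  also have "\<dots> = (\<Sum>l\<le>p. \<Sum>m\<le>p - l. b (l + m) * (real ((l + m) choose l) * (-1) ^ l * pochhammer (- x) l *
      pochhammer (u + real l) (l + m - l)))"
    by (rule triangle_swap)
  finally show ?thesis by (simp add: sum_distrib_left sum_distrib_right mult_ac)
qed

subsection \<open>Polynomial bases of Pochhammer symbols\<close>

lemma deg_lessI:
  assumes "\<And>i. i \<ge> n \<Longrightarrow> coeff p i = 0"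
  shows "deg_less p n"
  using assms unfolding deg_less_def by (metis leading_coeff_0_iff not_less)

lemma poly_basis:
  fixes B :: "nat \<Rightarrow> real poly"
  assumes "\<And>i. B i \<noteq> 0" "\<And>i. degree (B i) = i" "deg_less p n"
  shows "\<exists>c. p = (\<Sum>i<n. smult (c i) (B i))"
  using assms(3)
proof (induction n arbitrary: p)
  case 0
  then show ?case by (auto simp: deg_less_def)
next
  case (Suc n)
  define k where "k = coeff p n / lead_coeff (B n)"
  have "coeff (p - smult k (B n)) i = 0" if "i \<ge> n" for i
  proof (cases "i = n")
    case True
    moreover have "lead_coeff (B n) \<noteq> 0" using assms(1)[of n] by simp
    ultimately show ?thesis using assms(2)[of n] by (simp add: k_def)
  next
    case False
    then have "coeff p i = 0" "coeff (B n) i = 0"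
      using that Suc.prems assms(2)[of n] by (auto simp: deg_less_def intro: coeff_eq_0)
    then show ?thesis by simp
  qed
  then have "deg_less (p - smult k (B n)) n"
    by (rule deg_lessI)
  then obtain c where "p - smult k (B n) = (\<Sum>i<n. smult (c i) (B i))"
    using Suc.IH by blast
  then have "p = (\<Sum>i<Suc n. smult ((c(n := k)) i) (B i))"
    by (simp add: algebra_simps)
  then show ?case by blast
qed

lemma poly_pochhammer: "poly (pochhammer p i) x = pochhammer (poly p x) i"
  by (induction i) (auto simp: pochhammer_Suc)

text \<open>\<open>pochhammer [:u, v:] i\<close> is (u + v x)_i as a polynomial in x. For nonzero v
  there is one of these in each degree, so \<open>poly_basis\<close> applies to them.\<close>

lemma pochhammer_linear_poly:
  fixes u v :: real
  assumes "v \<noteq> 0"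
  shows "degree (pochhammer [:u, v:] i) = i \<and> lead_coeff (pochhammer [:u, v:] i) = v ^ i"
proof (induction i)
  case (Suc i)
  have *: "[:u, v:] + of_nat i = [:u + real i, v:]"
    by (simp add: of_nat_poly)
  have nz: "pochhammer [:u, v:] i \<noteq> 0"
    using Suc assms by (metis leading_coeff_0_iff power_not_zero)
  have nz': "[:u + real i, v:] \<noteq> 0" "degree [:u + real i, v:] = 1"
    using assms by auto
  have "degree (pochhammer [:u, v:] (Suc i)) = Suc i"
    unfolding pochhammer_Suc * using degree_mult_eq[OF nz nz'(1)] nz'(2) Suc by simp
  moreover have "lead_coeff (pochhammer [:u, v:] (Suc i)) = v ^ Suc i"
    unfolding pochhammer_Suc * lead_coeff_mult using conjunct2[OF Suc] nz'(2) by simp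
  ultimately show ?case by blast
qed simp

lemma pochhammer_basis:
  fixes u v :: real
  assumes "v \<noteq> 0" "deg_less p n"
  shows "\<exists>c. \<forall>x. poly p x = (\<Sum>i<n. c i * pochhammer (u + v * x) i)"
proof -
  have "pochhammer [:u, v:] i \<noteq> 0" for i
    using pochhammer_linear_poly[OF assms(1), of u i] assms(1)
    by (metis leading_coeff_0_iff power_not_zero)
  then obtain c where "p = (\<Sum>i<n. smult (c i) (pochhammer [:u, v:] i))"
    using poly_basis[of "\<lambda>i. pochhammer [:u, v:] i" p n] pochhammer_linear_poly[OF assms(1), of u]
      assms(2) by blast
  then have "poly p x = (\<Sum>i<n. c i * pochhammer (u + v * x) i)" for x
    by (simp add: poly_sum poly_pochhammer mult.commute)
  then show ?thesis by blast
qed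

text \<open>All basis functions except the last contain the factor s + \<beta> + m + 1, hence vanish
  at z = -\<beta> - m - 1. So the last coefficient is fixed by the value at z, where (z + 1)_m =
  (-1)^m (\<beta> + 1)_m is nonzero. The remainder is divisible by s - z, and induction applies to
  the quotient.\<close>

lemma beta_basis:
  assumes "\<beta> > (-1::real)" "degree p \<le> m"
  shows "\<exists>e. (\<forall>s. poly p s = (\<Sum>j\<le>m. e j * (pochhammer (s + 1) j * pochhammer (s + \<beta> + real j + 2) (m - j)))) \<and>
    e m * ((-1) ^ m * pochhammer (\<beta> + 1) m) = poly p (- \<beta> - real m - 1)"
  using assms(2)
proof (induction m arbitrary: p)
  case 0
  then obtain c where "p = [:c:]" by (metis degree_eq_zeroE le_zero_eq)
  then show ?case by (intro exI[of _ "\<lambda>_. c"]) simp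
next
  case (Suc m)
  define z where "z = - \<beta> - real (Suc m) - 1"
  define c where "c = poly p z / ((-1) ^ Suc m * pochhammer (\<beta> + 1) (Suc m))"
  have nz: "pochhammer (\<beta> + 1) (Suc m) \<noteq> 0"
    using assms(1) by (intro less_imp_neq[symmetric] pochhammer_pos) simp
  have gz: "pochhammer (z + 1) (Suc m) = (-1) ^ Suc m * pochhammer (\<beta> + 1) (Suc m)"
    using pochhammer_minus[of "\<beta> + real (Suc m)" "Suc m"] unfolding z_def by (simp add: algebra_simps)
  define g where "g = pochhammer [:1, 1::real:] (Suc m)"
  have g: "degree g = Suc m" "poly g s = pochhammer (s + 1) (Suc m)" for s
    using pochhammer_linear_poly[of 1 1 "Suc m"] by (simp_all add: g_def poly_pochhammer add.commute)
  have "poly (p - smult c g) z = 0"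
    using nz by (simp add: g gz c_def)
  then obtain q where q: "p - smult c g = [:- z, 1:] * q"
    by (metis poly_eq_0_iff_dvd dvdE)
  have "degree (p - smult c g) \<le> Suc m"
    using Suc.prems g(1) by (intro degree_diff_le) auto
  then have "degree q \<le> m"
    unfolding q by (cases "q = 0") (auto simp: degree_mult_eq simp del: mult_pCons_left)
  then obtain e where e: "poly q s = (\<Sum>j\<le>m. e j * (pochhammer (s + 1) j * pochhammer (s + \<beta> + real j + 2) (m - j)))" for s
    using Suc.IH by blast
  have "poly p s = (\<Sum>j\<le>Suc m. (e(Suc m := c)) j *
      (pochhammer (s + 1) j * pochhammer (s + \<beta> + real j + 2) (Suc m - j)))" for s
  proof -
    have "poly p s = poly (p - smult c g) s + c * poly g s" by simp
    also have "\<dots> = (s - z) * poly q s + c * pochhammer (s + 1) (Suc m)"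
      unfolding q g(2) by (simp add: algebra_simps)
    also have "(s - z) * poly q s = (\<Sum>j\<le>m. e j *
      (pochhammer (s + 1) j * pochhammer (s + \<beta> + real j + 2) (Suc m - j)))"
      unfolding e sum_distrib_left
    proof (rule sum.cong)
      fix j assume "j \<in> {..m}"
      \<comment> \<open>The last factor of the longer symbol is s - z, so multiplication by s - z
        carries the basis for m to the first m + 1 members of the basis for m + 1.\<close>
      then have "pochhammer (s + \<beta> + real j + 2) (Suc m - j) =
          pochhammer (s + \<beta> + real j + 2) (m - j) * (s - z)"
        by (simp add: Suc_diff_le pochhammer_Suc z_def of_nat_diff)
      then show "(s - z) * (e j * (pochhammer (s + 1) j * pochhammer (s + \<beta> + real j + 2) (m - j))) =
        e j * (pochhammer (s + 1) j * pochhammer (s + \<beta> + real j + 2) (Suc m - j))"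
        by simp
    qed simp
    finally show ?thesis by simp
  qed
  moreover have "(e(Suc m := c)) (Suc m) * ((-1) ^ Suc m * pochhammer (\<beta> + 1) (Suc m)) = poly p z"
    using nz by (simp add: c_def)
  ultimately show ?case unfolding z_def by blast
qed

subsection \<open>Lagrange interpolation\<close>

lemma prod_falling: "(\<Prod>i<q. x - real i) = pochhammer (x - real q + 1) q"
proof -
  have "(\<Prod>i<q. x - real i) = (\<Prod>i<q. - (- x + real i))" by simp
  also have "\<dots> = (-1) ^ q * pochhammer (- x) q"
    by (simp only: prod_uminus pochhammer_prod atLeast0LessThan card_lessThan)
  also have "\<dots> = pochhammer (x - real q + 1) q"
    by (simp add: pochhammer_minus)
  finally show ?thesis .
qed

lemma prod_falling_minus: "(\<Prod>i<q. - x - real i) = (-1) ^ q * pochhammer x q"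
  unfolding prod_falling pochhammer_minus'[of "- x" q] by simp

lemma prod_node_differences:
  assumes "k < p"
  shows "(\<Prod>i\<in>{..<p} - {k}. real k - real i) = (-1) ^ (p - 1 - k) * fact k * fact (p - 1 - k)"
proof -
  have split: "{..<p} - {k} = {..<k} \<union> {Suc k..<p}" using assms by auto
  have "(\<Prod>i\<in>{..<p} - {k}. real k - real i) =
      (\<Prod>i<k. real k - real i) * (\<Prod>i\<in>{Suc k..<p}. real k - real i)"
    unfolding split by (rule prod.union_disjoint) auto
  also have "(\<Prod>i<k. real k - real i) = fact k"
    by (simp add: prod_falling pochhammer_fact)
  also have "(\<Prod>i\<in>{Suc k..<p}. real k - real i) = (\<Prod>i<p - 1 - k. - (1::real) - real i)"
    using assms by (intro prod.reindex_bij_witness[of _ "\<lambda>i. i + Suc k" "\<lambda>i. i - Suc k"]) auto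
  also have "\<dots> = (-1) ^ (p - 1 - k) * fact (p - 1 - k)"
    by (simp only: prod_falling_minus pochhammer_fact)
  finally show ?thesis by simp
qed

text \<open>Apply the functional given by the c i and c' i to the polynomial L of degree m that
  vanishes at every node except A + k. The nodes leave only c k L(A + k). The expansion of L in the
  basis g leaves only \<gamma> times the last coefficient, which \<open>beta_basis\<close> expresses
  through L(z). The condition on the last Pochhammer symbol says that A + k is none of the nodes B +
  i.\<close>

lemma lagrange_coefficient:
  fixes A B \<beta> :: real and c c' :: "nat \<Rightarrow> real"
  defines "g \<equiv> \<lambda>m s j. pochhammer (s + 1) j * pochhammer (s + \<beta> + real j + 2) (m - j)"
  assumes \<beta>: "\<beta> > -1" and m: "m + 1 = p + q" and k: "k < p"
    and c: "\<And>j. j \<le> m \<Longrightarrow> (\<Sum>i<p. c i * g m (A + real i) j) + (\<Sum>i<q. c' i * g m (B + real i) j) =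
      (if j = m then \<gamma> else 0)"
    and x: "A + \<beta> + real m + 1 > 0"
    and y: "pochhammer (A - B + real k - real q + 1) q \<noteq> 0"
  shows "c k = \<gamma> * (-1) ^ (p - 1 - k) * pochhammer (A + \<beta> + real m + 1) p * pochhammer (B + \<beta> + real m + 1) q /
    ((A + \<beta> + real m + 1 + real k) * pochhammer (\<beta> + 1) m * fact k * fact (p - 1 - k) *
      pochhammer (A - B + real k - real q + 1) q)"
proof -
  define z where "z = - \<beta> - real m - 1"
  define L where "L = (\<Prod>i\<in>{..<p} - {k}. [:- (A + real i), 1:]) * (\<Prod>i<q. [:- (B + real i), 1:])"
  have L: "poly L s = (\<Prod>i\<in>{..<p} - {k}. s - A - real i) * (\<Prod>i<q. s - B - real i)" for s
    by (simp add: L_def poly_prod algebra_simps)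
  have "degree L \<le> (\<Sum>i\<in>{..<p} - {k}. degree [:- (A + real i), 1:]) + (\<Sum>i<q. degree [:- (B + real i), 1:])"
    unfolding L_def
    by (rule order_trans[OF degree_mult_le]) (intro add_mono order_trans[OF degree_prod_sum_le]; simp)
  then have "degree L \<le> m"
    using m k by simp
  then obtain e where e: "\<And>s. poly L s = (\<Sum>j\<le>m. e j * g m s j)"
      and em: "e m * ((-1) ^ m * pochhammer (\<beta> + 1) m) = poly L z"
    using beta_basis[OF \<beta>, of L m] unfolding g_def z_def by blast
  have "(\<Sum>i<p. c i * poly L (A + real i)) + (\<Sum>i<q. c' i * poly L (B + real i)) =
      (\<Sum>j\<le>m. e j * ((\<Sum>i<p. c i * g m (A + real i) j) + (\<Sum>i<q. c' i * g m (B + real i) j)))"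
    unfolding e sum_distrib_left distrib_left sum.distrib
    by (subst (1 2) sum.swap) (simp add: mult_ac)
  also have "\<dots> = (\<Sum>j\<le>m. if j = m then e m * \<gamma> else 0)"
    by (rule sum.cong) (auto simp: c)
  also have "\<dots> = e m * \<gamma>" by simp
  also have "(\<Sum>i<q. c' i * poly L (B + real i)) = 0"
  proof (rule sum.neutral, rule ballI)
    fix i assume "i \<in> {..<q}"
    then have "(\<Prod>i'<q. B + real i - B - real i') = 0" by (intro prod_zero) auto
    then show "c' i * poly L (B + real i) = 0" unfolding L by simp
  qed
  also have "(\<Sum>i<p. c i * poly L (A + real i)) = c k * poly L (A + real k)"
  proof -
    have "c i * poly L (A + real i) = 0" if "i \<in> {..<p} - {k}" for i
    proof -
      have "(\<Prod>i'\<in>{..<p} - {k}. A + real i - A - real i') = 0" using that by (intro prod_zero) auto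
      then show ?thesis unfolding L by simp
    qed
    then have "(\<Sum>i\<in>{..<p} - {k}. c i * poly L (A + real i)) = 0" by (intro sum.neutral) blast
    then show ?thesis using k by (subst sum.remove[of _ k]) auto
  qed
  also have "poly L (A + real k) = (-1) ^ (p - 1 - k) * fact k * fact (p - 1 - k) *
      pochhammer (A - B + real k - real q + 1) q"
    using prod_node_differences[OF k] prod_falling[of "A + real k - B" q] unfolding L by (simp add: algebra_simps)
  finally have 1: "c k * ((-1) ^ (p - 1 - k) * fact k * fact (p - 1 - k) *
      pochhammer (A - B + real k - real q + 1) q) = e m * \<gamma>" by simp
  \<comment> \<open>L omits the root A + k. Restoring its factor z - A - k = -(A + \<beta> + m + 1 +
    k) completes the product to a Pochhammer symbol.\<close>
  have "(\<Prod>i<p. z - A - real i) = (z - A - real k) * (\<Prod>i\<in>{..<p} - {k}. z - A - real i)"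
    using k by (subst prod.remove[of _ k]) auto
  then have "- (A + \<beta> + real m + 1 + real k) * poly L z = (\<Prod>i<p. z - A - real i) * (\<Prod>i<q. z - B - real i)"
    unfolding L by (simp add: z_def)
  moreover have "z - A = - (A + \<beta> + real m + 1)" "z - B = - (B + \<beta> + real m + 1)"
    by (simp_all add: z_def)
  ultimately have "- (A + \<beta> + real m + 1 + real k) * poly L z =
      (\<Prod>i<p. - (A + \<beta> + real m + 1) - real i) * (\<Prod>i<q. - (B + \<beta> + real m + 1) - real i)"
    by (simp only:)
  then have "- (A + \<beta> + real m + 1 + real k) * poly L z =
      ((-1) ^ p * pochhammer (A + \<beta> + real m + 1) p) * ((-1) ^ q * pochhammer (B + \<beta> + real m + 1) q)"
    unfolding prod_falling_minus .
  also have "\<dots> = (-1) ^ (p + q) * (pochhammer (A + \<beta> + real m + 1) p * pochhammer (B + \<beta> + real m + 1) q)"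
    by (simp add: power_add)
  also have "(-1) ^ (p + q) = - ((-1::real) ^ m)"
    unfolding m[symmetric] by simp
  finally have "(A + \<beta> + real m + 1 + real k) * poly L z =
      (-1) ^ m * (pochhammer (A + \<beta> + real m + 1) p * pochhammer (B + \<beta> + real m + 1) q)"
    by (simp only: mult_minus_left neg_equal_iff_equal)
  then have "(-1) ^ m * ((A + \<beta> + real m + 1 + real k) * (e m * pochhammer (\<beta> + 1) m)) =
      (-1) ^ m * (pochhammer (A + \<beta> + real m + 1) p * pochhammer (B + \<beta> + real m + 1) q)"
    unfolding em[symmetric] by (simp add: mult_ac)
  then have 2: "(A + \<beta> + real m + 1 + real k) * (e m * pochhammer (\<beta> + 1) m) =
      pochhammer (A + \<beta> + real m + 1) p * pochhammer (B + \<beta> + real m + 1) q"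
    by simp
  have nz: "pochhammer (\<beta> + 1) m \<noteq> 0" "A + \<beta> + real m + 1 + real k \<noteq> 0"
    using \<beta> x by (auto intro!: less_imp_neq[symmetric] pochhammer_pos)
  \<comment> \<open>Inserting the square of the sign moves it from the side of c k to the other
    side.\<close>
  have "c k * (fact k * fact (p - 1 - k) * pochhammer (A - B + real k - real q + 1) q) =
      ((-1) ^ (p - 1 - k) * (-1) ^ (p - 1 - k)) *
      (c k * (fact k * fact (p - 1 - k) * pochhammer (A - B + real k - real q + 1) q))"
    by (simp flip: power_mult_distrib)
  also have "\<dots> = (-1) ^ (p - 1 - k) * (c k * ((-1) ^ (p - 1 - k) * fact k * fact (p - 1 - k) *
      pochhammer (A - B + real k - real q + 1) q))"
    by (simp only: mult_ac)
  also have "\<dots> = e m * \<gamma> * (-1) ^ (p - 1 - k)"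
    unfolding 1 by (simp only: mult_ac)
  finally have "c k * (fact k * fact (p - 1 - k) * pochhammer (A - B + real k - real q + 1) q) =
      e m * \<gamma> * (-1) ^ (p - 1 - k)" .
  moreover have "e m = pochhammer (A + \<beta> + real m + 1) p * pochhammer (B + \<beta> + real m + 1) q /
      ((A + \<beta> + real m + 1 + real k) * pochhammer (\<beta> + 1) m)"
    using 2 nz by (intro eq_divide_imp) (simp_all add: mult_ac)
  ultimately have "c k * (fact k * fact (p - 1 - k) * pochhammer (A - B + real k - real q + 1) q) =
      \<gamma> * (-1) ^ (p - 1 - k) * pochhammer (A + \<beta> + real m + 1) p * pochhammer (B + \<beta> + real m + 1) q /
      ((A + \<beta> + real m + 1 + real k) * pochhammer (\<beta> + 1) m)"
    by simp
  then have "c k = \<gamma> * (-1) ^ (p - 1 - k) * pochhammer (A + \<beta> + real m + 1) p * pochhammer (B + \<beta> + real m + 1) q /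
      ((A + \<beta> + real m + 1 + real k) * pochhammer (\<beta> + 1) m) /
      (fact k * fact (p - 1 - k) * pochhammer (A - B + real k - real q + 1) q)"
    by (rule eq_divide_imp[rotated]) (use y in simp)
  then show ?thesis
    by (simp only: divide_divide_eq_left mult.assoc)
qed

text \<open>Denominators depending on k become numerators by taking complements in symbols free of
  k: (x)_(r+1+N-m) splits at k and k + N - m + 1, and (y)_m splits at k and k + q. With r = p - 1 in
  \<open>lagrange_coefficient\<close>, the dependence on k takes the form of a 3F2 summand.\<close>

lemma lagrange_coefficient_closed_form:
  fixes x y V W \<gamma> :: real
  assumes m: "m = r + q" and N: "m \<le> N" and k: "k \<le> r" and x: "x > 0"
    and y: "pochhammer y m \<noteq> 0"
  shows "\<gamma> * (-1) ^ (r - k) * pochhammer x (r + 1) * V /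
      ((x + real k) * W * fact k * fact (r - k) * pochhammer (y + real k) q) / pochhammer (x + real k + 1) (N - m) =
    (-1) ^ r * \<gamma> * V / (W * fact r * pochhammer (x + real r + 1) (N - m) * pochhammer y m) *
      ((-1) ^ k * real (r choose k) * pochhammer x k * pochhammer y k *
        pochhammer (x + real (N - m) + 1 + real k) (r - k) * pochhammer (y + real q + real k) (r - k))"
proof -
  define S T b where "S = pochhammer x (r + 1)" and "T = pochhammer (x + real r + 1) (N - m)"
    and "b = (x + real k) * pochhammer (x + real k + 1) (N - m)"
  define f g h where "f = pochhammer (x + real (N - m) + 1 + real k) (r - k)"
    and "g = pochhammer (y + real k) q" and "h = pochhammer (y + real q + real k) (r - k)"
  have b: "b = pochhammer (x + real k) (N - m + 1)"
    unfolding b_def by (simp add: pochhammer_rec)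
  have "S * T = pochhammer x (r + 1 + (N - m))"
    unfolding S_def T_def pochhammer_product'[of x "r + 1"] by (simp only: of_nat_add of_nat_1 add.assoc)
  also have "r + 1 + (N - m) = k + (N - m + 1) + (r - k)"
    using k by simp
  also have "pochhammer x \<dots> = pochhammer x k * b * f"
    unfolding pochhammer_product'[of x _ "r - k"] pochhammer_product'[of x k] b f_def
    by (simp add: add_ac)
  finally have 1: "S * T = pochhammer x k * b * f" .
  have "m = k + q + (r - k)" using m k by simp
  then have 2: "pochhammer y m = pochhammer y k * g * h"
    using pochhammer_product'[of y "k + q" "r - k"] pochhammer_product'[of y k q] unfolding g_def h_def
    by (simp add: add_ac)
  have nz: "b \<noteq> 0" "T \<noteq> 0" "g \<noteq> 0"
    using x y 2 unfolding b T_def by (auto intro!: less_imp_neq[symmetric] pochhammer_pos)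
  have 3: "(-1::real) ^ (r - k) = (-1) ^ r * (-1) ^ k" "real (r choose k) = fact r / (fact k * fact (r - k))"
    using k by (simp_all add: minus_one_power_iff binomial_fact)
  have "S / (b * g) = pochhammer x k * f * pochhammer y k * h / (T * pochhammer y m)"
  proof -
    have "S = pochhammer x k * b * f / T" using 1 nz by (simp add: field_simps)
    then have "S / (b * g) = pochhammer x k * f / T / g" using nz by simp
    also have "1 / g = pochhammer y k * h / pochhammer y m" using 2 y nz by (simp add: field_simps)
    then have "pochhammer x k * f / T / g = pochhammer x k * f / T * (pochhammer y k * h / pochhammer y m)"
      by (simp only: divide_inverse mult_1_left)
    finally show ?thesis by simp
  qed
  then have "(S / (b * g)) * (\<gamma> * (-1) ^ r * (-1) ^ k * V / (W * fact k * fact (r - k))) =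
      pochhammer x k * f * pochhammer y k * h / (T * pochhammer y m) *
      (\<gamma> * (-1) ^ r * (-1) ^ k * V / (W * fact k * fact (r - k)))" by simp
  then show ?thesis
    unfolding 3 S_def[symmetric] T_def[symmetric] f_def[symmetric] g_def[symmetric] h_def[symmetric] b_def
    by (simp add: mult_ac)
qed

subsection \<open>Hahn weights\<close>

lemma hahn_weight_pochhammer:
  assumes "\<alpha> > -1" "\<beta> > -1" "k \<le> N"
  shows "hahn_weight N \<alpha> \<beta> k =
    pochhammer (\<alpha> + 1) k / fact k * (pochhammer (\<beta> + 1) (N - k) / fact (N - k))"
proof -
  have "\<alpha> + 1 \<notin> \<int>\<^sub>\<le>\<^sub>0" "\<beta> + 1 \<notin> \<int>\<^sub>\<le>\<^sub>0"
    using assms by (auto elim!: nonpos_Ints_cases')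
  then have "pochhammer (\<alpha> + 1) k = Gamma (\<alpha> + real k + 1) / Gamma (\<alpha> + 1)"
    "pochhammer (\<beta> + 1) (N - k) = Gamma (\<beta> + real N - real k + 1) / Gamma (\<beta> + 1)"
    using assms(3) by (simp_all add: pochhammer_Gamma of_nat_diff algebra_simps)
  moreover have "fact k = Gamma (real k + 1)" "fact (N - k) = Gamma (real N - real k + 1)"
    using Gamma_fact[of k, where 'a = real] Gamma_fact[of "N - k", where 'a = real] assms(3)
    by (simp_all add: of_nat_diff add.commute)
  ultimately show ?thesis
    unfolding hahn_weight_def by simp
qed

text \<open>Both sides come from splitting (\<alpha> + 1)_(k+i) in two ways. This is why the
  polynomials are expanded in (\<alpha> + 1 + x)_i: each basis element only shifts the parameter of
  the weight.\<close>

lemma hahn_weight_shift: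
  assumes "\<alpha> > -1" "\<beta> > -1" "k \<le> N"
  shows "pochhammer (\<alpha> + 1 + real k) i * hahn_weight N \<alpha> \<beta> k =
    pochhammer (\<alpha> + 1) i * hahn_weight N (\<alpha> + real i) \<beta> k"
proof -
  have "pochhammer (\<alpha> + 1) k * pochhammer (\<alpha> + 1 + real k) i =
      pochhammer (\<alpha> + 1) i * pochhammer (\<alpha> + 1 + real i) k"
    using pochhammer_product'[of "\<alpha> + 1" k i] pochhammer_product'[of "\<alpha> + 1" i k]
    by (simp add: add.commute)
  then have "pochhammer (\<alpha> + 1 + real k) i * (pochhammer (\<alpha> + 1) k / fact k * r) =
      pochhammer (\<alpha> + 1) i * (pochhammer (\<alpha> + real i + 1) k / fact k * r)" for r
    by (simp add: field_simps)
  then show ?thesis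
    using assms by (simp add: hahn_weight_pochhammer)
qed

text \<open>The terms with k < j vanish. For k = j + r the factor (-k)_j cancels against the
  factorial in the weight, and the binomial theorem for Pochhammer symbols sums over r.\<close>

lemma hahn_factorial_moment:
  assumes "\<alpha> > -1" "\<beta> > -1" "j \<le> N"
  shows "(\<Sum>k=0..N. pochhammer (- real k) j * hahn_weight N \<alpha> \<beta> k) =
    (-1) ^ j / fact (N - j) * (pochhammer (\<alpha> + 1) j * pochhammer (\<alpha> + \<beta> + real j + 2) (N - j))"
proof -
  have "(\<Sum>k=0..N. pochhammer (- real k) j * hahn_weight N \<alpha> \<beta> k) =
      (\<Sum>k=j..N. pochhammer (- real k) j * hahn_weight N \<alpha> \<beta> k)"
    by (rule sum.mono_neutral_right) (auto simp: pochhammer_of_nat_eq_0_iff)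
  also have "\<dots> = (\<Sum>r\<le>N - j. pochhammer (- real (j + r)) j * hahn_weight N \<alpha> \<beta> (j + r))"
    using assms(3)
    by (intro sum.reindex_bij_witness[of _ "\<lambda>r. j + r" "\<lambda>k. k - j"]) auto
  also have "\<dots> = (\<Sum>r\<le>N - j. (-1) ^ j / fact (N - j) * pochhammer (\<alpha> + 1) j *
      (real ((N - j) choose r) * pochhammer (\<alpha> + real j + 1) r * pochhammer (\<beta> + 1) (N - j - r)))"
  proof (rule sum.cong)
    fix r assume r: "r \<in> {..N - j}"
    have 1: "pochhammer (- real (j + r)) j = (-1) ^ j * fact (j + r) / fact r"
    proof -
      have "fact (j + r) = (fact r :: real) * pochhammer (1 + real r) j"
        using pochhammer_product'[of "1::real" r j] by (simp add: pochhammer_fact add.commute)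
      then show ?thesis
        using pochhammer_minus[of "real (j + r)" j] by (simp add: add.commute)
    qed
    have 2: "hahn_weight N \<alpha> \<beta> (j + r) = pochhammer (\<alpha> + 1) j * pochhammer (\<alpha> + real j + 1) r / fact (j + r) *
        (pochhammer (\<beta> + 1) (N - j - r) / fact (N - j - r))"
      using assms r by (simp add: hahn_weight_pochhammer pochhammer_product' add_ac)
    have 3: "real ((N - j) choose r) = fact (N - j) / (fact r * fact (N - j - r))"
      using r by (simp add: binomial_fact)
    show "pochhammer (- real (j + r)) j * hahn_weight N \<alpha> \<beta> (j + r) = (-1) ^ j / fact (N - j) * pochhammer (\<alpha> + 1) j *
      (real ((N - j) choose r) * pochhammer (\<alpha> + real j + 1) r * pochhammer (\<beta> + 1) (N - j - r))"
      unfolding 1 2 3 by (simp add: field_simps)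
  qed simp
  also have "\<dots> = (-1) ^ j / fact (N - j) * pochhammer (\<alpha> + 1) j *
      pochhammer ((\<alpha> + real j + 1) + (\<beta> + 1)) (N - j)"
    by (simp only: pochhammer_binomial_sum sum_distrib_left)
  finally show ?thesis
    by (simp add: algebra_simps)
qed

lemma AT_system_not_shifted:
  assumes AT: "AT_system N w" and ab: "a \<in> {1, 2}" "b \<in> {1, 2}" "a \<noteq> b"
    and w: "\<And>c k. w c k = hahn_weight N (\<alpha> c) \<beta> k"
    and gt: "\<alpha> b > -1" "\<beta> > -1" and e: "e < m" "m \<le> N"
  shows "\<alpha> a \<noteq> \<alpha> b + real e"
proof
  assume shift: "\<alpha> a = \<alpha> b + real e"
  \<comment> \<open>By \<open>hahn_weight_shift\<close> this nontrivial combination vanishes at all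
    N + 1 points, whereas the multi-index with entries 1 and m permits at most m \<le> N
    zeros.\<close>
  define P where "P c = (if c = a then [:pochhammer (\<alpha> b + 1) e:] else - pochhammer [:\<alpha> b + 1, 1:] e)" for c
  define n where "n c = (if c = a then 1 else m)" for c
  have set: "{1, 2} = {a, b}" using ab by auto
  have pos: "pochhammer (\<alpha> b + 1) e > 0" using gt by (intro pochhammer_pos) simp
  have "linear_form w P k = 0" if "k \<le> N" for k
  proof -
    have "linear_form w P k = poly (P a) (real k) * w a k + poly (P b) (real k) * w b k"
      unfolding linear_form_def set using ab(3) by simp
    then show ?thesis
      using hahn_weight_shift[OF gt that, of e] ab(3) shift
      by (simp add: w P_def poly_pochhammer)
  qed
  then have zeros: "{k \<in> {0..N}. linear_form w P k = 0} = {0..N}" by auto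
  have size: "n 1 + n 2 = m + 1" using ab by (auto simp: n_def)
  have deg: "\<forall>c\<in>{1, 2}. deg_less (P c) (n c)"
    using ab(3) e(1) pochhammer_linear_poly[of 1 "\<alpha> b + 1" e]
    unfolding set by (auto simp: P_def n_def deg_less_def)
  have nontrivial: "\<exists>c\<in>{1, 2}. P c \<noteq> 0"
    using pos unfolding set by (auto simp: P_def)
  have "n 1 + n 2 \<le> N + 1" using size e(2) by simp
  then have "card {k \<in> {0..N}. linear_form w P k = 0} \<le> n 1 + n 2 - 1"
    using AT[unfolded AT_system_def, THEN spec[of _ n], THEN spec[of _ P]] deg nontrivial by blast
  then show False
    unfolding zeros size using e(2) by simp
qed

text \<open>Splitting the symbol of length N - j after m - j factors separates a part free of j,
  which can be absorbed into the coefficients, from the degree m basis function of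
  \<open>beta_basis\<close> at the node \<alpha> + i.\<close>

lemma hahn_weight_moment:
  assumes "\<alpha> > -1" "\<beta> > -1" "j \<le> m" "m \<le> N"
  shows "(\<Sum>k=0..N. pochhammer (- real k) j * ((\<Sum>i<p. b i * pochhammer (\<alpha> + 1 + real k) i) * hahn_weight N \<alpha> \<beta> k)) =
    (-1) ^ j / fact (N - j) * (\<Sum>i<p. b i * pochhammer (\<alpha> + 1) i * pochhammer (\<alpha> + \<beta> + real i + real m + 2) (N - m) *
      (pochhammer (\<alpha> + real i + 1) j * pochhammer (\<alpha> + real i + \<beta> + real j + 2) (m - j)))"
proof -
  have "(\<Sum>k=0..N. pochhammer (- real k) j * ((\<Sum>i<p. b i * pochhammer (\<alpha> + 1 + real k) i) * hahn_weight N \<alpha> \<beta> k)) =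
      (\<Sum>k=0..N. \<Sum>i<p. b i * (pochhammer (- real k) j * (pochhammer (\<alpha> + 1 + real k) i * hahn_weight N \<alpha> \<beta> k)))"
    by (simp add: sum_distrib_left sum_distrib_right mult_ac)
  also have "\<dots> = (\<Sum>i<p. \<Sum>k=0..N. b i * (pochhammer (- real k) j * (pochhammer (\<alpha> + 1 + real k) i * hahn_weight N \<alpha> \<beta> k)))"
    by (rule sum.swap)
  also have "\<dots> = (\<Sum>i<p. (-1) ^ j / fact (N - j) * (b i * pochhammer (\<alpha> + 1) i * pochhammer (\<alpha> + \<beta> + real i + real m + 2) (N - m) *
      (pochhammer (\<alpha> + real i + 1) j * pochhammer (\<alpha> + real i + \<beta> + real j + 2) (m - j))))"
  proof (rule sum.cong)
    fix i
    have "(\<Sum>k=0..N. b i * (pochhammer (- real k) j * (pochhammer (\<alpha> + 1 + real k) i * hahn_weight N \<alpha> \<beta> k))) =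
        (\<Sum>k=0..N. b i * pochhammer (\<alpha> + 1) i * (pochhammer (- real k) j * hahn_weight N (\<alpha> + real i) \<beta> k))"
      by (rule sum.cong) (simp_all add: hahn_weight_shift[OF assms(1,2)])
    also have "\<dots> = b i * pochhammer (\<alpha> + 1) i * ((-1) ^ j / fact (N - j) *
        (pochhammer (\<alpha> + real i + 1) j * pochhammer (\<alpha> + real i + \<beta> + real j + 2) (N - j)))"
      using assms by (simp add: sum_distrib_left[symmetric] hahn_factorial_moment)
    also have "pochhammer (\<alpha> + real i + \<beta> + real j + 2) (N - j) =
        pochhammer (\<alpha> + real i + \<beta> + real j + 2) (m - j) * pochhammer (\<alpha> + \<beta> + real i + real m + 2) (N - m)"
      using pochhammer_product'[of "\<alpha> + real i + \<beta> + real j + 2" "m - j" "N - m"] assms(3,4)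
      by (simp add: of_nat_diff algebra_simps)
    finally show "(\<Sum>k=0..N. b i * (pochhammer (- real k) j * (pochhammer (\<alpha> + 1 + real k) i * hahn_weight N \<alpha> \<beta> k))) =
        (-1) ^ j / fact (N - j) * (b i * pochhammer (\<alpha> + 1) i * pochhammer (\<alpha> + \<beta> + real i + real m + 2) (N - m) *
      (pochhammer (\<alpha> + real i + 1) j * pochhammer (\<alpha> + real i + \<beta> + real j + 2) (m - j)))"
      by simp
  qed simp
  finally show ?thesis by (simp add: sum_distrib_left)
qed

subsection \<open>Type I polynomials\<close>

text \<open>Orthogonality covers j < m. For j = m, the biorthogonality with one monic type II
  polynomial of degree m gives 1, and (-1)^m (-x)_m differs from that polynomial only by lower
  symbols (-x)_i, whose moments vanish.\<close>

lemma type_I_moments: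
  assumes I: "type_I N w QII n P"
    and II: "\<And>m1 m2. m1 + m2 \<le> N \<Longrightarrow> monic_type_II N w m1 m2 (QII m1 m2)"
    and n: "n 1 \<ge> 1" "n 1 + n 2 = m + 1" "m \<le> N" and j: "j \<le> m"
  shows "(\<Sum>k=0..N. pochhammer (- real k) j * linear_form w P k) = (if j = m then (-1) ^ m else 0)"
proof -
  have low: "(\<Sum>k=0..N. pochhammer (- real k) i * linear_form w P k) = 0" if "i < m" for i
    using I that n(2) unfolding type_I_def by auto
  \<comment> \<open>Lowering the first index by one gives total degree m = n_1 + n_2 - 1, the case
    with pairing 1; this uses n_1 \<ge> 1.\<close>
  define R where "R = QII (n 1 - 1) (n 2)"
  have m: "n 1 - 1 + n 2 = m" using n by simp
  have R: "lead_coeff R = 1" "degree R = m"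
    using II[of "n 1 - 1" "n 2"] n(3) unfolding R_def monic_type_II_def m by auto
  have one: "(\<Sum>k=0..N. linear_form w P k * poly R (real k)) = 1"
    using I n m unfolding type_I_def R_def by (metis Suc_eq_plus1)
  define T where "T = pochhammer [:0, -1::real:] m"
  have T: "degree T = m" "lead_coeff T = (-1) ^ m"
    using pochhammer_linear_poly[of "-1" 0 m] unfolding T_def by auto
  have "coeff (R - smult ((-1) ^ m) T) i = 0" if "i \<ge> m" for i
  proof (cases "i = m")
    case True
    then show ?thesis using R T by (simp flip: power_mult_distrib)
  next
    case False
    then show ?thesis using that R(2) T(1) by (simp add: coeff_eq_0)
  qed
  then have "deg_less (R - smult ((-1) ^ m) T) m"
    by (rule deg_lessI)
  then obtain c where c: "\<And>x. poly (R - smult ((-1) ^ m) T) x = (\<Sum>i<m. c i * pochhammer (0 + (-1) * x) i)"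
    using pochhammer_basis[of "-1" _ m 0] zero_neq_neg_one by metis
  have R_eq: "poly R x = (-1) ^ m * pochhammer (- x) m + (\<Sum>i<m. c i * pochhammer (- x) i)" for x
    using c[of x] by (simp add: T_def poly_pochhammer)
  have "(\<Sum>k=0..N. linear_form w P k * poly R (real k)) =
      (-1) ^ m * (\<Sum>k=0..N. pochhammer (- real k) m * linear_form w P k) +
      (\<Sum>k=0..N. \<Sum>i<m. c i * (pochhammer (- real k) i * linear_form w P k))"
    unfolding R_eq by (simp add: sum_distrib_left sum.distrib distrib_left mult_ac)
  also have "(\<Sum>k=0..N. \<Sum>i<m. c i * (pochhammer (- real k) i * linear_form w P k)) =
      (\<Sum>i<m. c i * (\<Sum>k=0..N. pochhammer (- real k) i * linear_form w P k))"
    by (subst sum.swap) (simp add: sum_distrib_left)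
  also have "\<dots> = 0" by (simp add: low)
  finally have "(-1) ^ m * (\<Sum>k=0..N. pochhammer (- real k) m * linear_form w P k) = 1"
    using one by simp
  then have "(-1) ^ m * ((-1) ^ m * (\<Sum>k=0..N. pochhammer (- real k) m * linear_form w P k)) = (-1) ^ m"
    by simp
  then have "(\<Sum>k=0..N. pochhammer (- real k) m * linear_form w P k) = (-1) ^ m"
    by (simp add: mult.assoc[symmetric] flip: power_mult_distrib)
  then show ?thesis using low j by auto
qed

text \<open>The factor (-p)_(l+m) is zero for l + m > p, so the infinite sum reduces to a finite
  triangle. Quotients with zero denominators outside the triangle have zero numerators and count as
  0.\<close>

lemma kampe_de_feriet_terminating:
  fixes p :: nat
  shows "kampe_de_feriet [- real p, a2] [b1, b2, b3] [c1] [d1, d2] [e1, e2] [] 1 1 =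
    (\<Sum>l\<le>p. \<Sum>m\<le>p - l. pochhammer (- real p) (l + m) * pochhammer a2 (l + m) /
        (pochhammer d1 (l + m) * pochhammer d2 (l + m)) *
      (pochhammer b1 l * pochhammer b2 l * pochhammer b3 l / (pochhammer e1 l * pochhammer e2 l)) *
      pochhammer c1 m / (fact l * fact m))"
proof -
  define f where "f l m = pochhammer (- real p) (l + m) * pochhammer a2 (l + m) /
        (pochhammer d1 (l + m) * pochhammer d2 (l + m)) *
      (pochhammer b1 l * pochhammer b2 l * pochhammer b3 l / (pochhammer e1 l * pochhammer e2 l)) *
      pochhammer c1 m / (fact l * fact m)" for l m
  have "kampe_de_feriet [- real p, a2] [b1, b2, b3] [c1] [d1, d2] [e1, e2] [] 1 1 =
      (\<Sum>\<^sub>\<infinity>(l, m)\<in>UNIV. f l m)"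
    unfolding kampe_de_feriet_def f_def by (simp add: pochhammers_def mult.assoc)
  also have "\<dots> = (\<Sum>\<^sub>\<infinity>(l, m)\<in>(SIGMA l:{..p}. {..p - l}). f l m)"
  proof (rule infsum_cong_neutral)
    fix lm assume lm: "lm \<in> UNIV - (SIGMA l:{..p}. {..p - l})"
    obtain l m where [simp]: "lm = (l, m)" by (cases lm)
    have "p < l + m" using lm by auto
    then show "(case lm of (l, m) \<Rightarrow> f l m) = 0"
      by (simp add: f_def pochhammer_of_nat_eq_0_iff)
  qed auto
  also have "\<dots> = (\<Sum>l\<le>p. \<Sum>m\<le>p - l. f l m)"
    by (simp add: sum.Sigma)
  finally show ?thesis unfolding f_def .
qed

section \<open>Determination of the coefficients and the two stated forms\<close>

lemma hahn_K_explicit: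
  assumes "a \<in> {1, 2}" "h = hat a" "n a = Suc p" "n h = q" "q \<ge> 1" "M = p + q"
  shows "hahn_K N \<alpha> \<beta> n a = (-1) ^ p * fact (N - M) * fact (M - 1) /
    (fact p * fact (q - 1) * pochhammer (\<beta> + 1) M * pochhammer (\<alpha> a + \<beta> + real M + 1 + real p + 1) (N - M)) *
    (pochhammer (\<alpha> h + \<beta> + real q + 1) M / pochhammer (\<alpha> a - \<alpha> h - real q + 1) M)"
proof -
  have size: "n 1 + n 2 = M + 1"
    and facts: "fact (n 1 - 1) * fact (n 2 - 1) = (fact p * fact (q - 1) :: real)"
    using assms by (auto simp: hat_def)
  have "real (n 1) + real (n 2) = real M + 1" using arg_cong[OF size, of real] by simp
  then have x: "\<alpha> a + \<beta> + real (n 1) + real (n 2) + real (n a) = \<alpha> a + \<beta> + real M + 1 + real p + 1"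
    using assms(3) by simp
  have nat: "n 1 + n 2 - 1 = M" "n 1 + n 2 - 2 = M - 1" "N + 1 - n 1 - n 2 = N - M" "n a - 1 = p"
    using size assms(3) by simp_all
  show ?thesis
    unfolding hahn_K_def assms(2)[symmetric] assms(4) x nat facts by simp
qed

lemma type_I_hahn_coefficients:
  assumes gt: "\<alpha> 1 > -1" "\<alpha> 2 > -1" "\<beta> > -1"
    and w: "\<And>b k. w b k = hahn_weight N (\<alpha> b) \<beta> k"
    and AT: "AT_system N w"
    and II: "\<And>m1 m2. m1 + m2 \<le> N \<Longrightarrow> monic_type_II N w m1 m2 (QII m1 m2)"
    and n: "n 1 \<ge> 1" "n 2 \<ge> 1" "n 1 + n 2 \<le> N + 1"
    and I: "type_I N w QII n Q"
    and a: "a \<in> {1, 2}"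
  shows "poly (Q a) x = (\<Sum>l<n a. hahn_C N \<alpha> \<beta> n a l * pochhammer (- x) l)"
proof -
  define h where "h = hat a"
  have ah: "{1, 2} = {a, h}" "a \<noteq> h" "hat a = h" "h \<in> {1, 2}"
    using a by (auto simp: h_def hat_def)
  have gt': "\<alpha> a > -1" "\<alpha> h > -1" using gt a ah(4) by auto
  define p where "p = n a - 1"
  define q where "q = n h"
  define M where "M = p + q"
  have pos: "n a \<ge> 1" "n h \<ge> 1" using n a ah(4) by auto
  then have na: "n a = Suc p" and nh: "n h = q" "q \<ge> 1" by (auto simp: p_def q_def)
  have "n 1 + n 2 = n a + n h" using a by (auto simp: h_def hat_def)
  then have nM: "n 1 + n 2 = M + 1" and MN: "M \<le> N" using na nh n(3) by (auto simp: M_def)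
  define A B where "A = \<alpha> a" and "B = \<alpha> h"
  have deg: "deg_less (Q a) (Suc p)" "deg_less (Q h) q"
    using I a ah(4) na nh unfolding type_I_def by auto
  obtain b where b: "\<And>x. poly (Q a) x = (\<Sum>i<Suc p. b i * pochhammer (A + 1 + x) i)"
    using pochhammer_basis[OF _ deg(1), of 1 "A + 1"] by auto
  obtain b' where b': "\<And>x. poly (Q h) x = (\<Sum>i<q. b' i * pochhammer (B + 1 + x) i)"
    using pochhammer_basis[OF _ deg(2), of 1 "B + 1"] by auto
  \<comment> \<open>The coefficients rescaled by the factors of \<open>hahn_weight_moment\<close>
    that do not involve j.\<close>
  define c where "c i = b i * pochhammer (A + 1) i * pochhammer (A + \<beta> + real i + real M + 2) (N - M)" for i
  define c' where "c' i = b' i * pochhammer (B + 1) i * pochhammer (B + \<beta> + real i + real M + 2) (N - M)" for i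
  define X where "X = A + \<beta> + real M + 1"
  define Y where "Y = A - B - real q + 1"
  define u where "u = B + \<beta> + real q + 1"
  have Xu: "X > 0" "u > 0" using gt' gt(3) nh by (simp_all add: X_def u_def A_def B_def M_def)
  \<comment> \<open>A zero would make the two parameters differ by an integer: \<alpha> a - \<alpha>
    h = q - 1 - k for some k < M = p + q. According to its sign, one of the two cases of
    \<open>AT_system_not_shifted\<close> excludes this.\<close>
  have Y: "pochhammer Y M \<noteq> 0"
  proof
    assume "pochhammer Y M = 0"
    then obtain k where k: "k < M" "Y = - real k" by (auto simp: pochhammer_eq_0_iff)
    show False
    proof (cases "k < q")
      case True
      then have "\<alpha> a = \<alpha> h + real (q - 1 - k)"
        using k by (simp add: Y_def A_def B_def of_nat_diff)
      then show False
        using AT_system_not_shifted[OF AT a ah(4) ah(2) w gt'(2) gt(3), of "q - 1 - k" q] nh MN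
        by (simp add: M_def)
    next
      case False
      then have "\<alpha> h = \<alpha> a + real (k + 1 - q)"
        using k by (simp add: Y_def A_def B_def of_nat_diff)
      moreover have "k + 1 - q < Suc p" "Suc p \<le> N"
        using k(1) False nh MN by (auto simp: M_def)
      ultimately show False
        using AT_system_not_shifted[OF AT ah(4) a ah(2)[symmetric] w gt'(1) gt(3), of "k + 1 - q" "Suc p"]
        by blast
    qed
  qed
  have mom: "(\<Sum>i<Suc p. c i * (pochhammer (A + real i + 1) j * pochhammer (A + real i + \<beta> + real j + 2) (M - j))) +
      (\<Sum>i<q. c' i * (pochhammer (B + real i + 1) j * pochhammer (B + real i + \<beta> + real j + 2) (M - j))) =
      (if j = M then fact (N - M) else 0)" (is "?S1 + ?S2 = _") if j: "j \<le> M" for j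
  proof -
    have "(if j = M then (-1) ^ M else 0) = (\<Sum>k=0..N. pochhammer (- real k) j * linear_form w Q k)"
      using type_I_moments[OF I II n(1) nM MN j] by simp
    also have "\<dots> = (\<Sum>k=0..N. pochhammer (- real k) j * ((\<Sum>i<Suc p. b i * pochhammer (A + 1 + real k) i) * hahn_weight N A \<beta> k)) +
        (\<Sum>k=0..N. pochhammer (- real k) j * ((\<Sum>i<q. b' i * pochhammer (B + 1 + real k) i) * hahn_weight N B \<beta> k))"
      unfolding linear_form_def ah(1) using ah(2)
      by (simp add: w b b' A_def B_def distrib_left sum.distrib del: sum.lessThan_Suc)
    also have "\<dots> = (-1) ^ j / fact (N - j) * (?S1 + ?S2)"
      using gt' gt(3) j MN unfolding A_def[symmetric] B_def[symmetric]
      by (simp only: hahn_weight_moment c_def c'_def distrib_left)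
    finally have "(if j = M then (-1) ^ M else 0) = (-1) ^ j / fact (N - j) * (?S1 + ?S2)" .
    \<comment> \<open>Stripping the common factor turns the moment value (-1)^M at j = M into (N -
      M)!, the constant \<gamma> of \<open>lagrange_coefficient\<close>.\<close>
    moreover have "S = (if j = M then fact (N - M) else 0)"
      if "(if j = M then (-1) ^ M else 0) = (-1) ^ j / fact (N - j) * S" for S :: real
      using that by (auto simp: minus_one_power_iff field_simps split: if_splits)
    ultimately show ?thesis by blast
  qed
  \<comment> \<open>The part of b k that is independent of k.\<close>
  define K where "K = (-1) ^ p * fact (N - M) * pochhammer (B + \<beta> + real M + 1) q /
    (pochhammer (\<beta> + 1) M * fact p * pochhammer (X + real p + 1) (N - M) * pochhammer Y M)"
  have bk: "b k = K * ((-1) ^ k * real (p choose k) * pochhammer X k * pochhammer Y k *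
        pochhammer (X + real (N - M) + 1 + real k) (p - k) * pochhammer (Y + real q + real k) (p - k)) /
        pochhammer (A + 1) k" if k: "k \<le> p" for k
  proof -
    \<comment> \<open>Since k + q \<le> M, the factors of this symbol are among those of
      (Y)_M.\<close>
    have Yk: "pochhammer (Y + real k) q \<noteq> 0"
    proof
      assume "pochhammer (Y + real k) q = 0"
      then obtain i where "i < q" "Y + real k = - real i" by (auto simp: pochhammer_eq_0_iff)
      then have "k + i < M \<and> Y = - real (k + i)" using k by (auto simp: M_def)
      then show False using Y unfolding pochhammer_eq_0_iff by blast
    qed
    have "c k = fact (N - M) * (-1) ^ (p - k) * pochhammer X (p + 1) * pochhammer (B + \<beta> + real M + 1) q /
      ((X + real k) * pochhammer (\<beta> + 1) M * fact k * fact (p - k) * pochhammer (Y + real k) q)"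
    proof -
      have shift: "A - B + real k - real q + 1 = Y + real k" by (simp add: Y_def)
      have "M + 1 = Suc p + q" "k < Suc p" using k by (simp_all add: M_def)
      moreover have "A + \<beta> + real M + 1 > 0" using Xu(1) by (simp add: X_def)
      moreover have "pochhammer (A - B + real k - real q + 1) q \<noteq> 0" unfolding shift by (rule Yk)
      ultimately show ?thesis
        using lagrange_coefficient[OF gt(3) _ _ mom, of k] unfolding shift X_def by simp
    qed
    moreover have "pochhammer (A + \<beta> + real k + real M + 2) (N - M) = pochhammer (X + real k + 1) (N - M)"
      by (simp add: X_def algebra_simps)
    ultimately have "b k * pochhammer (A + 1) k * pochhammer (X + real k + 1) (N - M) =
      fact (N - M) * (-1) ^ (p - k) * pochhammer X (p + 1) * pochhammer (B + \<beta> + real M + 1) q /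
      ((X + real k) * pochhammer (\<beta> + 1) M * fact k * fact (p - k) * pochhammer (Y + real k) q)"
      unfolding c_def by simp
    moreover have nz: "pochhammer (A + 1) k \<noteq> 0" "pochhammer (X + real k + 1) (N - M) \<noteq> 0"
      using gt'(1) Xu(1) by (auto simp: A_def intro!: less_imp_neq[symmetric] pochhammer_pos)
    ultimately have "b k * pochhammer (A + 1) k =
      fact (N - M) * (-1) ^ (p - k) * pochhammer X (p + 1) * pochhammer (B + \<beta> + real M + 1) q /
      ((X + real k) * pochhammer (\<beta> + 1) M * fact k * fact (p - k) * pochhammer (Y + real k) q) /
      pochhammer (X + real k + 1) (N - M)"
      by (metis nonzero_mult_div_cancel_right)
    also have "\<dots> = K * ((-1) ^ k * real (p choose k) * pochhammer X k * pochhammer Y k *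
        pochhammer (X + real (N - M) + 1 + real k) (p - k) * pochhammer (Y + real q + real k) (p - k))"
      unfolding K_def by (rule lagrange_coefficient_closed_form[OF M_def MN k Xu(1) Y])
    finally show ?thesis using nz by (simp add: field_simps)
  qed
  have KK: "hahn_K N \<alpha> \<beta> n a = K * (fact (M - 1) * pochhammer u p / fact (q - 1))"
  proof -
    \<comment> \<open>Splitting after p factors works because u + p = B + \<beta> + M + 1; the
      factor (u)_p is supplied by the reversal in \<open>thomae_reversed_sum\<close>.\<close>
    have "pochhammer u M = pochhammer u p * pochhammer (B + \<beta> + real M + 1) q"
      unfolding M_def pochhammer_product'[of u p q] by (simp add: u_def add_ac)
    then show ?thesis
      unfolding hahn_K_explicit[OF a h_def na nh M_def] K_def X_def Y_def u_def A_def B_def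
      by (simp add: mult_ac add_ac)
  qed
  have "(\<Sum>m\<le>p - l. b (l + m) * (real ((l + m) choose l) * (-1) ^ l * pochhammer (A + 1 + real l) m)) =
      hahn_C N \<alpha> \<beta> n a l" if l: "l \<le> p" for l
  proof -
    have nz: "pochhammer (A + 1) l \<noteq> 0"
      using gt'(1) by (auto simp: A_def intro!: less_imp_neq[symmetric] pochhammer_pos)
    have "(\<Sum>m\<le>p - l. b (l + m) * (real ((l + m) choose l) * (-1) ^ l * pochhammer (A + 1 + real l) m)) =
      (\<Sum>m\<le>p - l. (-1) ^ l * K / pochhammer (A + 1) l *
        (real ((l + m) choose l) * ((-1) ^ (l + m) * real (p choose (l + m)) *
      pochhammer X (l + m) * pochhammer Y (l + m) *
        pochhammer (X + real (N - M) + 1 + real (l + m)) (p - (l + m)) *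
        pochhammer (Y + real q + real (l + m)) (p - (l + m)))))"
    proof (rule sum.cong)
      fix m assume m: "m \<in> {..p - l}"
      have 1: "pochhammer (A + 1) (l + m) = pochhammer (A + 1) l * pochhammer (A + 1 + real l) m"
        by (rule pochhammer_product')
      have 2: "pochhammer (A + 1 + real l) m \<noteq> 0"
        using gt'(1) by (auto simp: A_def intro!: less_imp_neq[symmetric] pochhammer_pos)
      \<comment> \<open>The symbol (A + 1 + l)_m from the change of basis cancels the tail of (A +
        1)_(l+m), so only 1 / (A + 1)_l remains, outside the sum over m.\<close>
      have 3: "K * R / pochhammer (A + 1) (l + m) * (D * (-1) ^ l * pochhammer (A + 1 + real l) m) =
        (-1) ^ l * K / pochhammer (A + 1) l * (D * R)" for R D
        unfolding 1 using nz 2 by (simp add: field_simps)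
      have "l + m \<le> p" using l m by simp
      then show "b (l + m) * (real ((l + m) choose l) * (-1) ^ l * pochhammer (A + 1 + real l) m) =
         (-1) ^ l * K / pochhammer (A + 1) l *
        (real ((l + m) choose l) * ((-1) ^ (l + m) * real (p choose (l + m)) *
      pochhammer X (l + m) * pochhammer Y (l + m) *
        pochhammer (X + real (N - M) + 1 + real (l + m)) (p - (l + m)) *
        pochhammer (Y + real q + real (l + m)) (p - (l + m))))"
        by (simp only: bk 3)
    qed simp
    also have "\<dots> = (-1) ^ l * K / pochhammer (A + 1) l * ((-1) ^ l * pochhammer X l * pochhammer Y l *
      (fact (M - 1) * pochhammer u p / (fact (q - 1) * fact l * pochhammer (- real N) l)) *
      (\<Sum>m\<le>p - l. pochhammer (- real p) (l + m) * pochhammer (- real N) (l + m) * pochhammer (B - A - real p) m /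
        (fact m * pochhammer (- real (M - 1)) (l + m) * pochhammer u (l + m))))"
      unfolding sum_distrib_left[symmetric] Y_def u_def
      using thomae_reversed_sum[OF nh(2) M_def MN l _ X_def] Xu(2) unfolding u_def by simp
    also have "\<dots> = ((-1) ^ l * (-1) ^ l) * hahn_K N \<alpha> \<beta> n a *
      (pochhammer X l * pochhammer Y l / (fact l * pochhammer (A + 1) l * pochhammer (- real N) l)) *
      (\<Sum>m\<le>p - l. pochhammer (- real p) (l + m) * pochhammer (- real N) (l + m) * pochhammer (B - A - real p) m /
        (fact m * pochhammer (- real (M - 1)) (l + m) * pochhammer u (l + m)))"
      unfolding KK by (simp add: mult_ac)
    also have "(-1) ^ l * (-1) ^ l = (1::real)" by (simp flip: power_mult_distrib)
    also have "X = \<alpha> a + \<beta> + real (n 1) + real (n 2)"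
      using arg_cong[OF nM, of real] by (simp add: X_def A_def)
    also have "- real (M - 1) = - real (n 1) - real (n 2) + 2"
      using arg_cong[OF nM, of real] nh(2) by (simp add: M_def of_nat_diff)
    also have "- real p = - real (n a) + 1" by (simp add: na)
    also have "B - A - real p = \<alpha> h - \<alpha> a - real (n a) + 1" by (simp add: na A_def B_def)
    finally show ?thesis
      unfolding hahn_C_def ah(3) Y_def u_def A_def B_def nh(1) by (simp add: na atLeast0AtMost)
  qed
  then show ?thesis
    unfolding b na lessThan_Suc_atMost shifted_to_factorial_basis by simp
qed

lemma hahn_C_sum_eq_kampe_de_feriet:
  assumes "n a \<ge> 1"
  shows "(\<Sum>l<n a. hahn_C N \<alpha> \<beta> n a l * pochhammer (- x) l) =
     hahn_K N \<alpha> \<beta> n a *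
           kampe_de_feriet
             [- real (n a) + 1, - real N]
             [\<alpha> a + \<beta> + real (n 1) + real (n 2), \<alpha> a - \<alpha> (hat a) - real (n (hat a)) + 1, - x]
             [\<alpha> (hat a) - \<alpha> a - real (n a) + 1]
             [- real (n 1) - real (n 2) + 2, \<alpha> (hat a) + \<beta> + real (n (hat a)) + 1]
             [\<alpha> a + 1, - real N]
             []
             1 1"
proof -
  obtain p where p: "n a = Suc p" using assms by (cases "n a") auto
  have neg: "- real (n a) + 1 = - real p" by (simp add: p)
  show ?thesis
    unfolding hahn_C_def neg
    unfolding kampe_de_feriet_terminating
    unfolding p lessThan_Suc_atMost sum_distrib_left sum_distrib_right
    by (simp add: atLeast0AtMost mult_ac)
qed

theorem theorem2p1:
  fixes N :: nat and \<alpha> :: "nat \<Rightarrow> real" and \<beta> :: real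
    and w :: "nat \<Rightarrow> nat \<Rightarrow> real" and QII :: "nat \<Rightarrow> nat \<Rightarrow> real poly"
    and n :: "nat \<Rightarrow> nat" and Q :: "nat \<Rightarrow> real poly"
    and a :: nat and x :: real
  assumes "\<alpha> 1 > -1" and "\<alpha> 2 > -1" and "\<beta> > -1"
    and "\<And>b k. w b k = hahn_weight N (\<alpha> b) \<beta> k"
    and "AT_system N w"
    and "\<And>m1 m2. m1 + m2 \<le> N \<Longrightarrow> monic_type_II N w m1 m2 (QII m1 m2)"
    and "n 1 \<ge> 1" and "n 2 \<ge> 1" and "n 1 + n 2 \<le> N + 1"
    and "type_I N w QII n Q"
    and "a \<in> {1, 2}"
  shows "poly (Q a) x =
           hahn_K N \<alpha> \<beta> n a *
           kampe_de_feriet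
             [- real (n a) + 1, - real N]
             [\<alpha> a + \<beta> + real (n 1) + real (n 2), \<alpha> a - \<alpha> (hat a) - real (n (hat a)) + 1, - x]
             [\<alpha> (hat a) - \<alpha> a - real (n a) + 1]
             [- real (n 1) - real (n 2) + 2, \<alpha> (hat a) + \<beta> + real (n (hat a)) + 1]
             [\<alpha> a + 1, - real N]
             []
             1 1 \<and>
         poly (Q a) x = (\<Sum>l<n a. hahn_C N \<alpha> \<beta> n a l * pochhammer (- x) l)"
proof -
  have n: "n a \<ge> 1" using assms(7,8,11) by auto
  have C: "poly (Q a) x = (\<Sum>l<n a. hahn_C N \<alpha> \<beta> n a l * pochhammer (- x) l)"
    by (rule type_I_hahn_coefficients[OF assms])
  show ?thesis
    \<comment> \<open>Rewriting the series as the finite sum makes the two conjuncts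
      identical.\<close>
    unfolding hahn_C_sum_eq_kampe_de_feriet[of n a, OF n, symmetric] by (rule conjI[OF C C])
qed

end
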